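(* Let $\rho_{AB}$ be a two-qubit state whose marginal $\rho_A=\operatorname{Tr}_B\rho_{AB}$ is maximally mixed, $\rho_A=\mathbb I/2$. Let $R_{\mu\nu}=\operatorname{Tr}[(\sigma_\mu\otimes\sigma_\nu)\rho_{AB}]$ for $\mu,\nu\in\{0,1,2,3\}$, let $\hat{\mathbf R}=[R_{ij}]_{i,j\in\{1,2,3\}}$, and let $s_1\ge s_2\ge s_3\ge0$ be the singular values (including zeros) of $\hat{\mathbf R}$. Then $Q^A_{\mathcal N}(\rho_{AB})=s_2/2$.
   Context: $\sigma_0=\mathbb I,\sigma_1=\sigma_x,\sigma_2=\sigma_y,\sigma_3=\sigma_z$. The negativity of a bipartite state $\tau_{X:Y}$ is $\mathcal N_{X:Y}(\tau)=(\|\tau^\Gamma\|_1-1)/2$ with $\tau^\Gamma$ the partial transpose on one party and $\|\cdot\|_1$ the trace norm. For $A$ of dimension $m$ and an orthonormal basis $\{|a_k\rangle\}$ of $A$, the measurement interaction is the isometry $V:A\to A\otimes A'$ ($A'$ $m$-dimensional with computational basis $\{|k\rangle\}$), $V|a_k\rangle=|a_k\rangle|k\rangle$. The one-sided negativity of quantumness is $Q^A_{\mathcal N}(\rho_{AB})=\min\mathcal N_{AB:A'}\big((V\otimes\mathbb I_B)\rho_{AB}(V\otimes\mathbb I_B)^\dagger\big)$ over all orthonormal bases of $A$. *)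

theory Defs
  imports "Jordan_Normal_Form.Jordan_Normal_Form"
begin

definition cadj :: "complex mat \<Rightarrow> complex mat" where
  "cadj A = mat (dim_col A) (dim_row A) (\<lambda>(i,j). cnj (A $$ (j,i)))"

definition kron :: "complex mat \<Rightarrow> complex mat \<Rightarrow> complex mat" where
  "kron A B = mat (dim_row A * dim_row B) (dim_col A * dim_col B)
     (\<lambda>(i,j). A $$ (i div dim_row B, j div dim_col B) * B $$ (i mod dim_row B, j mod dim_col B))"

definition pauli :: "nat \<Rightarrow> complex mat" where
  "pauli mu = (if mu = 0 then mat_of_rows_list 2 [[1,0],[0,1]]
     else if mu = 1 then mat_of_rows_list 2 [[0,1],[1,0]]
     else if mu = 2 then mat_of_rows_list 2 [[0,-\<i>],[\<i>,0]]
     else mat_of_rows_list 2 [[1,0],[0,-1]])"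

definition eigvals :: "complex mat \<Rightarrow> complex list" where
  "eigvals A = (SOME as. length as = dim_row A \<and> char_poly A = (\<Prod>a\<leftarrow>as. [:- a, 1:]))"

definition singular_values :: "complex mat \<Rightarrow> real list" where
  "singular_values A = rev (sort (map (\<lambda>a. sqrt (Re a)) (eigvals (cadj A * A))))"

definition trace_norm :: "complex mat \<Rightarrow> real" where
  "trace_norm A = sum_list (singular_values A)"

definition mtrace :: "complex mat \<Rightarrow> complex" where
  "mtrace A = (\<Sum>i<dim_row A. A $$ (i,i))"

definition density :: "nat \<Rightarrow> complex mat \<Rightarrow> bool" where
  "density n \<rho> \<longleftrightarrow> \<rho> \<in> carrier_mat n n \<and> cadj \<rho> = \<rho> \<and> mtrace \<rho> = 1 \<and>
     (\<forall>v \<in> carrier_vec n. 0 \<le> Re (\<Sum>i<n. cnj (v $ i) * (\<rho> *\<^sub>v v) $ i))"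

definition ptrace_B :: "complex mat \<Rightarrow> complex mat" where
  "ptrace_B \<rho> = mat 2 2 (\<lambda>(i,j). \<Sum>k<2. \<rho> $$ (2*i+k, 2*j+k))"

definition onb :: "nat \<Rightarrow> complex vec list \<Rightarrow> bool" where
  "onb m as \<longleftrightarrow> length as = m \<and> (\<forall>k<m. as ! k \<in> carrier_vec m) \<and>
     (\<forall>k<m. \<forall>l<m. (\<Sum>i<m. cnj (as ! k $ i) * (as ! l $ i)) = (if k = l then 1 else 0))"

(* measurement interaction V : A -> A (x) A', V|a_k> = |a_k>|k>, i.e.
   V = sum_k (|a_k> (x) |k>) <a_k| ; as an (m*m) x m matrix, ordering A then A' *)
definition meas_iso :: "nat \<Rightarrow> complex vec list \<Rightarrow> complex mat" where
  "meas_iso m as = mat (m*m) m (\<lambda>(i,j).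
     \<Sum>k<m. (as ! k $ (i div m)) * (if i mod m = k then 1 else 0) * cnj (as ! k $ j))"

definition post_state :: "complex vec list \<Rightarrow> complex mat \<Rightarrow> complex mat" where
  "post_state as \<rho> = (let W = kron (meas_iso 2 as) (1\<^sub>m 2) in W * \<rho> * cadj W)"

(* partial transpose on the middle factor of C^dL (x) C^dM (x) C^dR;
   index i = (x*dM + y)*dR + z *)
definition ptrans_mid :: "nat \<Rightarrow> nat \<Rightarrow> nat \<Rightarrow> complex mat \<Rightarrow> complex mat" where
  "ptrans_mid dL dM dR \<tau> = mat (dL*dM*dR) (dL*dM*dR) (\<lambda>(i,j).
     \<tau> $$ ((i div (dM*dR) * dM + (j div dR) mod dM) * dR + i mod dR,
           (j div (dM*dR) * dM + (i div dR) mod dM) * dR + j mod dR))"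

definition negativity_AB_A' :: "complex mat \<Rightarrow> real" where
  "negativity_AB_A' \<tau> = (trace_norm (ptrans_mid 2 2 2 \<tau>) - 1) / 2"

definition QN_A :: "complex mat \<Rightarrow> real" where
  "QN_A \<rho> = Inf {negativity_AB_A' (post_state as \<rho>) | as. onb 2 as}"

definition Rhat :: "complex mat \<Rightarrow> complex mat" where
  "Rhat \<rho> = mat 3 3 (\<lambda>(i,j). mtrace (kron (pauli (i+1)) (pauli (j+1)) * \<rho>))"

end

theory Submission
  imports Defs "Jordan_Normal_Form.Schur_Decomposition" "HOL-Analysis.Cross3"
begin

text \<open>
  In the measured basis \<open>a\<^sub>0, a\<^sub>1\<close> the partial transpose of the post-measurement state sends
  \<open>|a\<^sub>l\<rangle>|k\<rangle>\<close> to \<open>|a\<^sub>k\<rangle>|l\<rangle>\<close> while acting by \<open>\<rho>\<^sub>k\<^sub>l = \<langle>a\<^sub>k|\<rho>|a\<^sub>l\<rangle>\<close> on \<open>B\<close>, so its trace norm is the sum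
  of the trace norms of the four blocks. The diagonal blocks contribute the total trace 1, and the
  negativity is the trace norm of \<open>\<rho>\<^sub>0\<^sub>1\<close>. Since the marginal is maximally mixed, \<open>4 \<rho>\<^sub>0\<^sub>1 = w \<cdot> \<sigma>\<close> with
  \<open>w = R\<^sup>T (u + iv)\<close>, where \<open>u, v\<close> is an orthonormal basis of the plane orthogonal to the Bloch vector of
  \<open>a\<^sub>0\<close>. The closed form of the trace norm of a \<open>2 \<times> 2\<close> matrix then gives half of the largest value of
  \<open>|R\<^sup>T x|\<close> over unit vectors \<open>x\<close> of that plane. Every plane occurs, and by Courant-Fischer the minimum
  over all planes is half of the second singular value.
\<close>

hide_const (open) VectorSpace.subspace Finite_Cartesian_Product.mat Determinants.det Finite_Cartesian_Product.vec
no_notation vec_nth (infixl "$" 90)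
hide_type (open) Finite_Cartesian_Product.vec

section \<open>Adjoints, singular values and characteristic polynomials\<close>

lemma cadj_carrier [simp]: "A \<in> carrier_mat n m \<Longrightarrow> cadj A \<in> carrier_mat m n"
  by (auto simp: cadj_def)

lemma cadj_dim [simp]: "dim_row (cadj A) = dim_col A" "dim_col (cadj A) = dim_row A"
  by (auto simp: cadj_def)

lemma cadj_index [simp]: "i < dim_col A \<Longrightarrow> j < dim_row A \<Longrightarrow> cadj A $$ (i,j) = cnj (A $$ (j,i))"
  by (auto simp: cadj_def)

lemma mat_mult_index:
  assumes "A \<in> carrier_mat n m" "B \<in> carrier_mat m l" "i < n" "j < l"
  shows "(A * B) $$ (i,j) = (\<Sum>k<m. A $$ (i,k) * B $$ (k,j))"
  using assms by (auto simp: scalar_prod_def lessThan_atLeast0 intro!: sum.cong)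

lemma cadj_mult:
  assumes "A \<in> carrier_mat n m" "B \<in> carrier_mat m l"
  shows "cadj (A * B) = cadj B * cadj A"
proof (rule eq_matI)
  fix i j assume "i < dim_row (cadj B * cadj A)" "j < dim_col (cadj B * cadj A)"
  then have ij: "i < l" "j < n" using assms by auto
  have "cadj (A * B) $$ (i,j) = cnj ((A * B) $$ (j,i))"
    using assms ij by (intro cadj_index) auto
  also have "\<dots> = (\<Sum>k<m. cadj B $$ (i,k) * cadj A $$ (k,j))"
    using assms ij by (subst mat_mult_index[OF assms]) (auto intro!: sum.cong)
  also have "\<dots> = (cadj B * cadj A) $$ (i,j)"
    using assms ij by (subst mat_mult_index[of _ l m _ n]) auto
  finally show "cadj (A * B) $$ (i,j) = (cadj B * cadj A) $$ (i,j)" .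
qed (use assms in auto)

lemma proots_linear_factors:
  "proots (\<Prod>a\<leftarrow>as. [:- a, 1:]) = mset (as :: complex list)"
proof (induction as)
  case (Cons a as)
  have "(\<Prod>a\<leftarrow>as. [:- a, 1:]) \<noteq> 0"
    by (auto simp: prod_list_zero_iff)
  then show ?case
    using Cons by (simp add: proots_mult del: mult_pCons_left)
qed auto

text \<open>\<open>eigvals\<close> chooses some factorization of the characteristic polynomial. The
  roots are unique up to order and sorting removes the order, so any explicit real list of roots can
  replace the choice.\<close>

lemma singular_values_eqI:
  assumes A: "A \<in> carrier_mat n n"
    and cp: "char_poly (cadj A * A) = (\<Prod>l\<leftarrow>ls. [:- complex_of_real l, 1:])"
  shows "singular_values A = rev (sort (map sqrt ls))"
proof -
  let ?P = "\<lambda>as. length as = dim_row (cadj A * A) \<and> char_poly (cadj A * A) = (\<Prod>a\<leftarrow>as. [:- a, 1:])"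
  have "cadj A * A \<in> carrier_mat n n" using A by auto
  from char_poly_factorized[OF this] have "\<exists>as. ?P as" using A by auto
  then have "?P (eigvals (cadj A * A))"
    unfolding eigvals_def by (rule someI_ex)
  then have "(\<Prod>a\<leftarrow>eigvals (cadj A * A). [:- a, 1:]) = (\<Prod>a\<leftarrow>map complex_of_real ls. [:- a, 1:])"
    using cp by (simp add: o_def)
  then have "mset (eigvals (cadj A * A)) = mset (map complex_of_real ls)"
    by (metis proots_linear_factors)
  then have "image_mset (\<lambda>a. sqrt (Re a)) (mset (eigvals (cadj A * A)))
      = image_mset (\<lambda>a. sqrt (Re a)) (mset (map complex_of_real ls))"
    by simp
  then have "mset (map (\<lambda>a. sqrt (Re a)) (eigvals (cadj A * A))) = mset (map sqrt ls)"
    by (simp add: image_mset.compositionality o_def)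
  then have "sort (map (\<lambda>a. sqrt (Re a)) (eigvals (cadj A * A))) = sort (map sqrt ls)"
    by (metis properties_for_sort mset_sort sorted_sort)
  then show ?thesis
    by (simp add: singular_values_def)
qed

lemma trace_norm_eqI:
  assumes "A \<in> carrier_mat n n"
    and "char_poly (cadj A * A) = (\<Prod>l\<leftarrow>ls. [:- complex_of_real l, 1:])"
  shows "trace_norm A = (\<Sum>l\<leftarrow>ls. sqrt l)"
proof -
  have "sum_list (rev (sort (map sqrt ls))) = sum_list (map sqrt ls)"
    by (metis mset_rev mset_sort sum_mset_sum_list)
  then show ?thesis
    by (simp add: trace_norm_def singular_values_eqI[OF assms])
qed

lemma char_poly_unitary_conj:
  assumes A: "A \<in> carrier_mat n n" and T: "T \<in> carrier_mat n n"
    and uni: "cadj T * T = 1\<^sub>m n"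
  shows "char_poly (cadj T * A * T) = char_poly A"
proof -
  have T': "cadj T \<in> carrier_mat n n" using T by simp
  have "T * cadj T = 1\<^sub>m n"
    by (rule mat_mult_left_right_inverse[OF T' T uni])
  then have "similar_mat_wit (cadj T * A * T) A (cadj T) T"
    using A T T' uni by (intro similar_mat_witI[of _ _ n]) auto
  then show ?thesis
    by (intro char_poly_similar) (auto simp: similar_mat_def)
qed

text \<open>Singular values are read off \<open>cadj R * R\<close>, whereas the negativity leads to
  the form of \<open>R * cadj R\<close>. Block determinants also cover singular matrices, where
  \<open>A * B\<close> and \<open>B * A\<close> need not be similar.\<close>

lemma char_poly_mult_commute:
  fixes A B :: "'a :: idom mat"
  assumes A: "A \<in> carrier_mat n n" and B: "B \<in> carrier_mat n n"
  shows "char_poly (A * B) = char_poly (B * A)"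
proof -
  define c where "c = map_mat (\<lambda>a::'a. [:a:])"
  define X where "X = [:0, 1::'a:] \<cdot>\<^sub>m 1\<^sub>m n"
  have X: "X \<in> carrier_mat n n" by (simp add: X_def)
  have c: "c M \<in> carrier_mat n n" if "M \<in> carrier_mat n n" for M
    using that by (simp add: c_def)
  have cA: "c A \<in> carrier_mat n n" and cB: "c B \<in> carrier_mat n n" using c A B by auto
  have c_mult: "c (M * N) = c M * c N" if "M \<in> carrier_mat n n" "N \<in> carrier_mat n n" for M N
  proof -
    interpret h: semiring_hom "\<lambda>a::'a. [:a:]" by unfold_locales auto
    show ?thesis unfolding c_def by (rule h.mat_hom_mult[OF that])
  qed
  have cp: "char_poly M = det (X - c M)" if "M \<in> carrier_mat n n" for M
    unfolding char_poly_def char_poly_matrix_def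
    by (rule arg_cong[of _ _ det], rule eq_matI) (use that in \<open>auto simp: X_def c_def\<close>)
  let ?O = "1\<^sub>m n :: 'a poly mat" and ?Z = "0\<^sub>m n n :: 'a poly mat"
  \<comment> \<open>Both determinants are Schur complements of one block matrix, up to the block swap \<open>S\<close>.\<close>
  define S where "S = four_block_mat ?Z ?O ?O ?Z"
  define M where "M = four_block_mat X (c A) (c B) ?O"
  define N where "N = four_block_mat ?O (c B) (c A) X"
  have S: "S \<in> carrier_mat (n+n) (n+n)" and M: "M \<in> carrier_mat (n+n) (n+n)"
    unfolding S_def M_def using X cA cB by auto
  have SS: "S * S = 1\<^sub>m (n+n)"
    unfolding S_def by (subst mult_four_block_mat[of _ n n _ n _ n _ _ n _ n]) auto
  have SM: "S * M = four_block_mat (c B) ?O X (c A)"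
    unfolding S_def M_def using X cA cB
    by (subst mult_four_block_mat[of _ n n _ n _ n _ _ n _ n]) auto
  have SMS: "S * M * S = N"
    unfolding SM unfolding S_def N_def using X cA cB
    by (subst mult_four_block_mat[of _ n n _ n _ n _ _ n _ n]) auto
  have "det N = det S * det M * det S"
    unfolding SMS[symmetric] using S M by (simp add: det_mult[of _ "n+n"])
  moreover have "det S * det S = 1"
    using det_mult[OF S S] by (simp add: SS)
  ultimately have NM: "det N = det M"
    by (metis mult.assoc mult.commute mult_1)
  have "det M = det (X * ?O - c A * c B)"
    unfolding M_def by (rule det_four_block_mat[of _ n]) (use X cA cB in auto)
  moreover have "det N = det (?O * X - c B * c A)"
    unfolding N_def
  proof (rule det_four_block_mat[of _ n])
    \<comment> \<open>The block determinant formula asks the two lower blocks to commute;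
      \<open>X\<close> is a scalar matrix.\<close>
    show "c A * X = X * c A"
      using cA by (simp add: X_def mult_smult_distrib[of _ n n _ n] mult_smult_assoc_mat[of _ n n _ n])
  qed (use X cA cB in auto)
  ultimately show ?thesis
    using NM X A B by (simp add: cp c_mult)
qed

lemma det_2x2:
  assumes "A \<in> carrier_mat 2 2"
  shows "det A = A $$ (0,0) * A $$ (1,1) - A $$ (1,0) * A $$ (0,1)"
  using assms
  by (subst laplace_expansion_column[of A 2 0])
    (auto simp: numeral_2_eq_2 cofactor_def det_single mat_delete_def)

lemma char_poly_2x2:
  assumes "A \<in> carrier_mat 2 2"
  shows "char_poly A = [:det A, - (A $$ (0,0) + A $$ (1,1)), 1:]"
proof -
  have "char_poly_matrix A \<in> carrier_mat 2 2" using assms by simp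
  from det_2x2[OF this] show ?thesis
    using assms by (simp add: char_poly_def det_2x2 char_poly_matrix_def)
qed

section \<open>The spectral theorem and the min-max principle in dimension three\<close>

text \<open>Compactness of the unit sphere of \<open>S\<close> gives a maximizer \<open>e\<close>,
  and the vanishing first variation at \<open>e\<close> is the eigenvalue equation. Since
  \<open>f\<close> may leave \<open>S\<close>, the equation is stated tested against vectors of
  \<open>S\<close>.\<close>

lemma self_adjoint_max_on_subspace:
  fixes f :: "'a::euclidean_space \<Rightarrow> 'a"
  assumes lin: "linear f" and sa: "\<And>x y. inner x (f y) = inner (f x) y"
    and S: "subspace S" and z: "z \<in> S" "z \<noteq> 0"
  obtains e where "e \<in> S" "norm e = 1"
    "\<And>x. x \<in> S \<Longrightarrow> inner x (f x) \<le> inner e (f e) * inner x x"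
    "\<And>x. x \<in> S \<Longrightarrow> inner x (f e) = inner e (f e) * inner x e"
proof -
  define K where "K = S \<inter> sphere 0 1"
  have "compact K"
    unfolding K_def by (rule closed_Int_compact[OF closed_subspace[OF S] compact_sphere])
  moreover have "z /\<^sub>R norm z \<in> K"
    using z S by (auto simp: K_def subspace_scale)
  moreover have "continuous_on K (\<lambda>x. inner x (f x))"
    by (intro continuous_intros linear_continuous_on lin[unfolded linear_conv_bounded_linear])
  ultimately obtain e where e: "e \<in> K" and emax: "\<And>x. x \<in> K \<Longrightarrow> inner x (f x) \<le> inner e (f e)"
    using continuous_attains_sup[of K "\<lambda>x. inner x (f x)"] by blast
  define l where "l = inner e (f e)"
  have eS: "e \<in> S" and ne: "norm e = 1" using e by (auto simp: K_def)
  then have ee: "inner e e = 1" by (simp add: norm_eq_1)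
  have max: "inner x (f x) \<le> l * inner x x" if x: "x \<in> S" for x
  proof (cases "x = 0")
    case False
    have "x /\<^sub>R norm x \<in> K" using x S False by (auto simp: K_def subspace_scale)
    from emax[OF this] have "inner x (f x) / (norm x)\<^sup>2 \<le> l"
      by (simp add: l_def linear_scale[OF lin] power2_eq_square field_simps)
    then show ?thesis
      using False by (simp add: field_simps power2_norm_eq_inner)
  qed (simp add: linear_0[OF lin])
  have eig: "inner x (f e) = l * inner x e" if x: "x \<in> S" for x
  proof -
    define B where "B = l * inner x e - inner x (f e)"
    define C where "C = l * inner x x - inner x (f x)"
    have sym: "inner e (f x) = inner x (f e)" by (metis sa inner_commute)
    \<comment> \<open>Maximality is applied to the perturbed vector \<open>e + t x\<close>; the
      terms of order zero cancel.\<close>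
    have nonneg: "0 \<le> 2 * t * B + t\<^sup>2 * C" for t
    proof -
      have "e + t *\<^sub>R x \<in> S" using eS x S by (simp add: subspace_add subspace_scale)
      from max[OF this] show ?thesis
        by (simp add: B_def C_def l_def[symmetric] linear_add[OF lin] linear_scale[OF lin] inner_add_left inner_add_right
            ee sym inner_commute[of e x] power2_eq_square algebra_simps)
    qed
    have "B = 0"
    proof (rule ccontr)
      assume B: "B \<noteq> 0"
      have C: "0 \<le> C" using max[OF x] by (simp add: C_def)
      \<comment> \<open>A small step against the sign of \<open>B\<close> makes the linear term win.
        The denominator \<open>C + 1\<close> stays positive even when \<open>C = 0\<close>.\<close>
      have "2 * (- B / (C + 1)) * B + (- B / (C + 1))\<^sup>2 * C = - (B\<^sup>2 * (C + 2) / (C + 1)\<^sup>2)"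
        using C by (simp add: divide_simps) (simp add: power2_eq_square algebra_simps)
      moreover have "0 < B\<^sup>2 * (C + 2) / (C + 1)\<^sup>2" using B C by simp
      ultimately show False using nonneg[of "- B / (C + 1)"] by linarith
    qed
    then show ?thesis by (simp add: B_def)
  qed
  show ?thesis
    using that[OF eS ne] max eig by (simp add: l_def)
qed

definition diag3 :: "real \<Rightarrow> real \<Rightarrow> real \<Rightarrow> real^3^3" where
  "diag3 a b c = vector [vector [a, 0, 0], vector [0, b, 0], vector [0, 0, c]]"

text \<open>The form is maximized first on the whole space, then on the plane orthogonal to
  \<open>e1\<close>; the cross product completes the basis. The eigenvectors are the rows of
  \<open>E\<close>, and maximality yields the ordering of the eigenvalues.\<close>

lemma real_symmetric_diagonalization_3:
  fixes A :: "real^3^3"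
  assumes sym: "transpose A = A"
  obtains E a b c where "orthogonal_matrix E" "E ** A ** transpose E = diag3 a b c" "a \<ge> b" "b \<ge> c"
proof -
  let ?f = "\<lambda>x. A *v x"
  have lin: "linear ?f" by (rule matrix_vector_mul_linear)
  have sa: "inner x (?f y) = inner (?f x) y" for x y
    by (metis dot_lmul_matrix sym transpose_matrix_vector)
  have "axis 1 1 \<noteq> (0::real^3)" by (simp add: axis_eq_0_iff)
  then obtain e1 where e1: "norm e1 = 1"
    and max1: "\<And>x. inner x (?f x) \<le> inner e1 (?f e1) * inner x x"
    and eig1: "\<And>x. inner x (?f e1) = inner e1 (?f e1) * inner x e1"
    using self_adjoint_max_on_subspace[OF lin sa subspace_UNIV UNIV_I] by (metis UNIV_I)
  obtain z where z: "z \<noteq> 0" "orthogonal e1 z"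
    by (rule orthogonal_to_vector_exists[of e1]) auto
  obtain e2 where e2: "inner e1 e2 = 0" "norm e2 = 1"
    and max2: "\<And>x. inner e1 x = 0 \<Longrightarrow> inner x (?f x) \<le> inner e2 (?f e2) * inner x x"
    and eig2: "\<And>x. inner e1 x = 0 \<Longrightarrow> inner x (?f e2) = inner e2 (?f e2) * inner x e2"
    using self_adjoint_max_on_subspace[OF lin sa subspace_hyperplane[of e1] _ z(1)] z(2)
    unfolding orthogonal_def mem_Collect_eq by metis
  define e3 where "e3 = cross3 e1 e2"
  have e3: "inner e1 e3 = 0" "inner e2 e3 = 0"
    by (simp_all add: e3_def dot_cross_self)
  have "(norm e3)\<^sup>2 = 1"
    using norm_cross_dot[of e1 e2] e1 e2 by (simp add: e3_def)
  then have "norm e3 = 1"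
    by (simp only: power2_norm_eq_inner norm_eq_1)
  note unit = e1[unfolded norm_eq_1] e2(2)[unfolded norm_eq_1] this[unfolded norm_eq_1]
  note orth = e2(1) e3 e2(1)[unfolded inner_commute[of e1]] e3(1)[unfolded inner_commute[of e1]]
    e3(2)[unfolded inner_commute[of e2]]
  define E :: "real^3^3" where "E = vector [e1, e2, e3]"
  have E_conj: "vec_nth (vec_nth (E ** B ** transpose E) i) j = inner (vec_nth E i) (B *v vec_nth E j)" for B i j
    by (simp add: matrix_matrix_mult_def matrix_vector_mult_def transpose_def inner_vec_def
        sum_3 algebra_simps)
  have E_gram: "vec_nth (vec_nth (E ** transpose E) i) j = inner (vec_nth E i) (vec_nth E j)" for i j
    using E_conj[of "Finite_Cartesian_Product.mat 1" i j] by simp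
  have "E ** transpose E = Finite_Cartesian_Product.mat 1"
    unfolding vec_eq_iff forall_3 E_gram by (simp add: E_def unit orth mat_def)
  then have "orthogonal_matrix E"
    by (simp add: orthogonal_matrix_def matrix_left_right_inverse)
  moreover have "E ** A ** transpose E = diag3 (inner e1 (?f e1)) (inner e2 (?f e2)) (inner e3 (?f e3))"
  proof -
    \<comment> \<open>Self-adjointness moves \<open>?f\<close> onto the vector whose eigenvalue
      equation is known.\<close>
    have "inner e1 (?f e2) = 0" "inner e1 (?f e3) = 0" "inner e2 (?f e3) = 0"
      using eig1[of e2] eig1[of e3] eig2[of e3] orth
      by (metis sa inner_commute mult_zero_right)+
    then show ?thesis
      using eig1[of e2] eig1[of e3] eig2[of e3] orth
      unfolding vec_eq_iff forall_3 E_conj by (simp add: E_def diag3_def)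
  qed
  moreover have "inner e2 (?f e2) \<le> inner e1 (?f e1)" "inner e3 (?f e3) \<le> inner e2 (?f e2)"
    using max1[of e2] max2[of e3] unit orth by auto
  ultimately show ?thesis using that by blast
qed

section \<open>Quadratic forms restricted to planes\<close>

text \<open>Twice the larger eigenvalue of the symmetric form with matrix \<open>a, c; c, b\<close>.\<close>
definition top_eig2 :: "real \<Rightarrow> real \<Rightarrow> real \<Rightarrow> real" where
  "top_eig2 a b c = a + b + sqrt ((a - b)\<^sup>2 + 4 * c\<^sup>2)"

text \<open>In the double angle, \<open>?p\<close> and \<open>?q\<close> being its cosine and sine,
  twice the form is \<open>a + b\<close> plus a linear expression, which Cauchy-Schwarz
  bounds.\<close>

lemma top_eig2_ge:
  assumes "x\<^sup>2 + y\<^sup>2 = 1"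
  shows "2 * (a * x\<^sup>2 + 2 * c * x * y + b * y\<^sup>2) \<le> top_eig2 a b c"
proof -
  let ?p = "x\<^sup>2 - y\<^sup>2" and ?q = "2 * x * y"
  have pq: "?p\<^sup>2 + ?q\<^sup>2 = 1"
  proof -
    have "?p\<^sup>2 + ?q\<^sup>2 = (x\<^sup>2 + y\<^sup>2)\<^sup>2" by (simp add: power2_eq_square algebra_simps)
    then show ?thesis using assms by simp
  qed
  \<comment> \<open>By the Lagrange identity the two sides differ by exactly one square.\<close>
  have "(?p * (a - b) + ?q * (2 * c))\<^sup>2 \<le> (?p\<^sup>2 + ?q\<^sup>2) * ((a - b)\<^sup>2 + (2 * c)\<^sup>2)"
    using zero_le_power2[of "?p * (2 * c) - ?q * (a - b)"]
    by (simp add: power2_eq_square algebra_simps)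
  then have *: "?p * (a - b) + ?q * (2 * c) \<le> sqrt ((a - b)\<^sup>2 + 4 * c\<^sup>2)"
    by (intro real_le_rsqrt) (simp add: pq)
  have "2 * (a * x\<^sup>2 + 2 * c * x * y + b * y\<^sup>2)
     = (a + b) * (x\<^sup>2 + y\<^sup>2) + (?p * (a - b) + ?q * (2 * c))"
    by (simp add: algebra_simps)
  then have "2 * (a * x\<^sup>2 + 2 * c * x * y + b * y\<^sup>2) = a + b + (?p * (a - b) + ?q * (2 * c))"
    by (simp only: assms mult_1_right)
  then show ?thesis
    using * by (simp only: top_eig2_def add_left_mono)
qed

text \<open>The matrix of \<open>m\<close> times the identity minus the form is positive
  semidefinite, so its diagonal and determinant are nonnegative. The bound on the root follows from
  (2m - a - b)^2 - (a - b)^2 = 4 (m - a)(m - b).\<close>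

lemma top_eig2_le:
  assumes "\<And>x y. a * x\<^sup>2 + 2 * c * x * y + b * y\<^sup>2 \<le> m * (x\<^sup>2 + y\<^sup>2)"
  shows "top_eig2 a b c \<le> 2 * m"
proof -
  have ab: "a \<le> m" "b \<le> m" using assms[of 1 0] assms[of 0 1] by auto
  have disc: "c\<^sup>2 \<le> (m - a) * (m - b)"
  proof (cases "m = a")
    case True
    show ?thesis
    proof (rule ccontr)
      assume "\<not> ?thesis"
      then have c: "c \<noteq> 0" using True by auto
      \<comment> \<open>With \<open>m = a\<close> the terms in x^2 cancel, and this \<open>x\<close>
        makes the cross term exceed \<open>m - b\<close> by 1.\<close>
      have "2 * c * ((m - b + 1) / (2 * c)) * 1 + b \<le> m"
        using assms[of "(m - b + 1) / (2 * c)" 1] True by (simp add: algebra_simps)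
      then show False using c by simp
    qed
  next
    case False
    \<comment> \<open>The test vector \<open>(c, m - a)\<close> is annihilated by the first row
      \<open>(m - a, - c)\<close>, so only \<open>m - a\<close> times the determinant
      remains.\<close>
    have "0 \<le> m * (c\<^sup>2 + (m - a)\<^sup>2) - (a * c\<^sup>2 + 2 * c * c * (m - a) + b * (m - a)\<^sup>2)"
      using assms[of c "m - a"] by simp
    also have "\<dots> = (m - a) * ((m - a) * (m - b) - c\<^sup>2)"
      by (simp add: power2_eq_square algebra_simps)
    finally have "0 \<le> (m - a) * (m - b) - c\<^sup>2"
      using False ab by (simp add: zero_le_mult_iff)
    then show ?thesis by simp
  qed
  have "sqrt ((a - b)\<^sup>2 + 4 * c\<^sup>2) \<le> 2 * m - a - b"
    using disc ab by (intro real_le_lsqrt) (auto simp: power2_eq_square algebra_simps)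
  then show ?thesis by (simp add: top_eig2_def)
qed

lemma quadratic_form_diag3:
  fixes A E :: "real^3^3"
  assumes E: "orthogonal_matrix E" "E ** A ** transpose E = diag3 a b c"
  shows "inner x (A *v x) = a * (inner (vec_nth E 1) x)\<^sup>2 + b * (inner (vec_nth E 2) x)\<^sup>2
      + c * (inner (vec_nth E 3) x)\<^sup>2" (is ?A)
    and "inner x x = (inner (vec_nth E 1) x)\<^sup>2 + (inner (vec_nth E 2) x)\<^sup>2 + (inner (vec_nth E 3) x)\<^sup>2" (is ?B)
proof -
  define y where "y = E *v x"
  have y: "vec_nth y i = inner (vec_nth E i) x" for i
    by (simp add: y_def matrix_vector_mult_def inner_vec_def)
  have x: "x = transpose E *v y"
    using E(1) by (simp add: y_def orthogonal_matrix_def matrix_vector_mul_assoc)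
  have tr: "inner (transpose E *v y) w = inner y (E *v w)" for w
    by (metis dot_lmul_matrix vector_transpose_matrix transpose_matrix_vector)
  have "inner x (A *v x) = inner y (diag3 a b c *v y)"
    unfolding E(2)[symmetric] by (subst (1 2) x) (simp only: tr matrix_vector_mul_assoc matrix_mul_assoc)
  then show ?A
    unfolding y[symmetric] by (simp add: diag3_def inner_vec_def[of y] sum_3 matrix_vector_mult_def power2_eq_square)
  have "inner x x = inner y y"
    by (subst (1) x) (simp only: tr, simp only: y_def)
  then show ?B
    unfolding y[symmetric] by (simp add: inner_vec_def[of y] sum_3 power2_eq_square)
qed

lemma matrix_form_lincomb:
  fixes A :: "real^3^3"
  assumes "transpose A = A"
  shows "inner (x *\<^sub>R u + y *\<^sub>R v) (A *v (x *\<^sub>R u + y *\<^sub>R v))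
    = inner u (A *v u) * x\<^sup>2 + 2 * inner u (A *v v) * x * y + inner v (A *v v) * y\<^sup>2"
proof -
  have "inner v (A *v u) = inner u (A *v v)"
    by (metis dot_lmul_matrix assms transpose_matrix_vector inner_commute)
  then show ?thesis
    by (simp add: matrix_vector_right_distrib matrix_vector_mult_scaleR inner_add_left inner_add_right
        power2_eq_square algebra_simps)
qed

text \<open>Lower half of Courant-Fischer: every plane contains a unit vector orthogonal to the
  third eigenvector, and there the form is at least \<open>b\<close>.\<close>

lemma top_eig2_plane_ge:
  fixes A E :: "real^3^3"
  assumes E: "orthogonal_matrix E" "E ** A ** transpose E = diag3 a b c" "a \<ge> b"
    and sym: "transpose A = A"
    and uv: "inner u u = 1" "inner v v = 1" "inner u v = 0"
  shows "2 * b \<le> top_eig2 (inner u (A *v u)) (inner v (A *v v)) (inner u (A *v v))"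
proof -
  define p q where "p = inner (vec_nth E 3) u" and "q = inner (vec_nth E 3) v"
  \<comment> \<open>One linear condition on two coordinates: the normalized \<open>(q, - p)\<close>
    solves it, and any unit vector does when both coefficients vanish.\<close>
  obtain x y :: real where xy: "x\<^sup>2 + y\<^sup>2 = 1" "x * p + y * q = 0"
  proof (cases "p = 0 \<and> q = 0")
    case True
    then show ?thesis using that[of 1 0] by simp
  next
    case False
    then have pos: "p\<^sup>2 + q\<^sup>2 > 0" by (simp add: sum_power2_gt_zero_iff)
    let ?r = "sqrt (p\<^sup>2 + q\<^sup>2)"
    show ?thesis
    proof (rule that[of "q / ?r" "- p / ?r"])
      show "(q / ?r)\<^sup>2 + (- p / ?r)\<^sup>2 = 1"
        using False by (simp add: power_divide add_divide_distrib[symmetric] add.commute)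
    qed (simp add: field_simps)
  qed
  define z where "z = x *\<^sub>R u + y *\<^sub>R v"
  have z3: "inner (vec_nth E 3) z = 0"
    using xy by (simp add: z_def inner_add_right p_def q_def)
  have zz: "inner z z = 1"
    using xy uv by (simp add: z_def inner_add_left inner_add_right inner_commute[of v u] power2_eq_square)
  have "b = b * ((inner (vec_nth E 1) z)\<^sup>2 + (inner (vec_nth E 2) z)\<^sup>2)"
    using quadratic_form_diag3(2)[OF E(1,2), of z] z3 zz by simp
  also have "\<dots> \<le> a * (inner (vec_nth E 1) z)\<^sup>2 + b * (inner (vec_nth E 2) z)\<^sup>2"
    using E(3) by (simp add: distrib_left mult_right_mono)
  also have "\<dots> = inner z (A *v z)"
    using quadratic_form_diag3(1)[OF E(1,2), of z] z3 by simp
  finally have "b \<le> inner z (A *v z)" .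
  moreover have "2 * inner z (A *v z) \<le> top_eig2 (inner u (A *v u)) (inner v (A *v v)) (inner u (A *v v))"
    unfolding z_def matrix_form_lincomb[OF sym] by (rule top_eig2_ge[OF xy(1)])
  ultimately show ?thesis by linarith
qed

text \<open>Upper half of Courant-Fischer: on the plane orthogonal to the top eigenvector only the
  eigenvalues \<open>b\<close> and \<open>c\<close> are seen.\<close>

lemma top_eig2_plane_le:
  fixes A E :: "real^3^3"
  assumes E: "orthogonal_matrix E" "E ** A ** transpose E = diag3 a b c" "b \<ge> c"
    and sym: "transpose A = A"
    and uv: "inner u u = 1" "inner v v = 1" "inner u v = 0"
    and perp: "inner (vec_nth E 1) u = 0" "inner (vec_nth E 1) v = 0"
  shows "top_eig2 (inner u (A *v u)) (inner v (A *v v)) (inner u (A *v v)) \<le> 2 * b"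
proof (rule top_eig2_le)
  fix x y :: real
  define z where "z = x *\<^sub>R u + y *\<^sub>R v"
  have z1: "inner (vec_nth E 1) z = 0"
    using perp by (simp add: z_def inner_add_right)
  have zz: "inner z z = x\<^sup>2 + y\<^sup>2"
    using uv by (simp add: z_def inner_add_left inner_add_right inner_commute[of v u] power2_eq_square)
  have "inner z (A *v z) = b * (inner (vec_nth E 2) z)\<^sup>2 + c * (inner (vec_nth E 3) z)\<^sup>2"
    using quadratic_form_diag3(1)[OF E(1,2), of z] z1 by simp
  also have "\<dots> \<le> b * ((inner (vec_nth E 2) z)\<^sup>2 + (inner (vec_nth E 3) z)\<^sup>2)"
    using E(3) by (simp add: distrib_left mult_right_mono)
  also have "\<dots> = b * (x\<^sup>2 + y\<^sup>2)"
    using quadratic_form_diag3(2)[OF E(1,2), of z] z1 zz by simp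
  finally show "inner u (A *v u) * x\<^sup>2 + 2 * inner u (A *v v) * x * y + inner v (A *v v) * y\<^sup>2
      \<le> b * (x\<^sup>2 + y\<^sup>2)"
    unfolding z_def matrix_form_lincomb[OF sym] .
qed

section \<open>The partially transposed post-measurement state\<close>

text \<open>The squared sum of the two singular values is the squared Frobenius norm plus twice the
  modulus of the determinant. The second claim keeps the squared singular values themselves, so that
  block spectra can be concatenated.\<close>

lemma trace_norm_2x2:
  assumes M: "M \<in> carrier_mat 2 2"
  shows "trace_norm M = sqrt ((cmod (M $$ (0,0)))\<^sup>2 + (cmod (M $$ (0,1)))\<^sup>2 + (cmod (M $$ (1,0)))\<^sup>2
      + (cmod (M $$ (1,1)))\<^sup>2 + 2 * cmod (M $$ (0,0) * M $$ (1,1) - M $$ (1,0) * M $$ (0,1)))" (is "_ = sqrt (?t + 2 * ?r)")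
    and "\<exists>l m. char_poly (cadj M * M) = (\<Prod>x\<leftarrow>[l, m]. [:- complex_of_real x, 1:])
      \<and> trace_norm M = sqrt l + sqrt m"
proof -
  define t r where "t = ?t" and "r = ?r"
  have r0: "0 \<le> r" by (simp add: r_def)
  \<comment> \<open>The arithmetic-geometric mean inequality for each product in the determinant
    makes the discriminant below nonnegative.\<close>
  have tr: "2 * r \<le> t"
  proof -
    have "r \<le> cmod (M $$ (0,0)) * cmod (M $$ (1,1)) + cmod (M $$ (1,0)) * cmod (M $$ (0,1))"
      unfolding r_def by (metis norm_mult norm_triangle_ineq4)
    then show ?thesis
      using zero_le_power2[of "cmod (M $$ (0,0)) - cmod (M $$ (1,1))"]
        zero_le_power2[of "cmod (M $$ (1,0)) - cmod (M $$ (0,1))"]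
      by (simp add: t_def power2_diff)
  qed
  define s where "s = sqrt (t\<^sup>2 - (2 * r)\<^sup>2)"
  have "(2 * r)\<^sup>2 \<le> t\<^sup>2" using tr r0 by (intro power_mono) auto
  then have s2: "s\<^sup>2 = t\<^sup>2 - (2 * r)\<^sup>2" and s0: "0 \<le> s" by (auto simp: s_def)
  have st: "s \<le> t" using tr r0 by (simp add: s_def real_le_lsqrt)
  \<comment> \<open>The eigenvalues of the Gram matrix: the roots of the quadratic with trace
    \<open>t\<close> and determinant r^2.\<close>
  define l m where "l = (t + s) / 2" and "m = (t - s) / 2"
  have lm0: "0 \<le> l" "0 \<le> m" using st s0 tr r0 by (auto simp: l_def m_def)
  have lm: "l + m = t" "l * m = r\<^sup>2"
    using s2 by (auto simp: l_def m_def power2_eq_square field_simps)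
  define H where "H = cadj M * M"
  have H: "H \<in> carrier_mat 2 2" unfolding H_def by (rule mult_carrier_mat[OF cadj_carrier[OF M] M])
  have ent: "H $$ (i,j) = cnj (M $$ (0,i)) * M $$ (0,j) + cnj (M $$ (1,i)) * M $$ (1,j)"
    if "i < 2" "j < 2" for i j
    unfolding H_def using M that by (subst mat_mult_index[of _ 2 2 _ 2]) (auto simp: numeral_2_eq_2)
  have "complex_of_real t = H $$ (0,0) + H $$ (1,1)"
    unfolding t_def of_real_add complex_norm_square by (simp add: ent ac_simps)
  moreover have "complex_of_real (r\<^sup>2) = det H"
  proof -
    have "complex_of_real (r\<^sup>2) = cnj (M $$ (0,0) * M $$ (1,1) - M $$ (1,0) * M $$ (0,1)) *
        (M $$ (0,0) * M $$ (1,1) - M $$ (1,0) * M $$ (0,1))"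
      unfolding r_def complex_norm_square by (simp add: mult.commute)
    also have "\<dots> = det H"
      by (simp add: det_2x2[OF H] ent algebra_simps)
    finally show ?thesis .
  qed
  ultimately have "char_poly H = [:of_real (l * m), - of_real (l + m), 1:]"
    by (simp only: char_poly_2x2[OF H] lm)
  then have cp: "char_poly (cadj M * M) = (\<Prod>x\<leftarrow>[l, m]. [:- complex_of_real x, 1:])"
    by (simp add: H_def)
  have tn: "trace_norm M = sqrt l + sqrt m"
    using trace_norm_eqI[OF M cp] by simp
  have "(sqrt l + sqrt m)\<^sup>2 = l + m + 2 * sqrt (l * m)"
    using lm0 by (simp add: power2_sum real_sqrt_mult)
  also have "\<dots> = t + 2 * r" using r0 by (simp add: lm)
  finally have "sqrt l + sqrt m = sqrt (t + 2 * r)"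
    using lm0 by (metis real_sqrt_unique add_nonneg_nonneg real_sqrt_ge_zero)
  then show "trace_norm M = sqrt (?t + 2 * ?r)"
    by (simp add: tn t_def r_def)
  show "\<exists>l m. char_poly (cadj M * M) = (\<Prod>x\<leftarrow>[l, m]. [:- complex_of_real x, 1:])
      \<and> trace_norm M = sqrt l + sqrt m"
    using cp tn by blast
qed

lemma char_poly_block_diag:
  fixes A B :: "complex mat"
  assumes A: "A \<in> carrier_mat n n" and B: "B \<in> carrier_mat m m"
  shows "char_poly (four_block_mat A (0\<^sub>m n m) (0\<^sub>m m n) B) = char_poly A * char_poly B"
  by (rule char_poly_0_block[OF refl _ _ A _ B]) (use char_poly_factorized[OF A] char_poly_factorized[OF B] in auto)

text \<open>The operator \<open>\<langle>a\<^sub>k|\<rho>|a\<^sub>l\<rangle>\<close> on \<open>B\<close>.\<close>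
definition basis_block :: "complex vec list \<Rightarrow> complex mat \<Rightarrow> nat \<Rightarrow> nat \<Rightarrow> complex mat" where
  "basis_block as \<rho> k l = mat 2 2 (\<lambda>(z,w).
     \<Sum>p<2. \<Sum>q<2. cnj (as ! k $ p) * \<rho> $$ (2*p+z, 2*q+w) * (as ! l $ q))"

lemma basis_block_carrier [simp]: "basis_block as \<rho> k l \<in> carrier_mat 2 2"
  by (simp add: basis_block_def)

lemma basis_block_index:
  assumes "z < 2" "w < 2"
  shows "basis_block as \<rho> k l $$ (z,w) =
      cnj (as ! k $ 0) * \<rho> $$ (z,w) * (as ! l $ 0) + cnj (as ! k $ 0) * \<rho> $$ (z,2+w) * (as ! l $ 1)
    + cnj (as ! k $ 1) * \<rho> $$ (2+z,w) * (as ! l $ 0) + cnj (as ! k $ 1) * \<rho> $$ (2+z,2+w) * (as ! l $ 1)"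
  using assms by (simp add: basis_block_def numeral_2_eq_2)

lemma onb_inner:
  assumes "onb 2 as" "k < 2" "l < 2"
  shows "cnj (as ! k $ 0) * (as ! l $ 0) + cnj (as ! k $ 1) * (as ! l $ 1) = (if k = l then 1 else 0)"
  using assms by (auto simp: onb_def numeral_2_eq_2)

lemma sum_lessThan_4: "(\<Sum>i<4::nat. f i) = f 0 + f 1 + f 2 + (f 3 :: 'a::comm_monoid_add)"
  by (simp add: eval_nat_numeral add.assoc)

lemma sum_lessThan_8:
  "(\<Sum>i<8::nat. f i) = f 0 + f 1 + f 2 + f 3 + f 4 + f 5 + f 6 + (f 7 :: 'a::comm_monoid_add)"
  by (simp add: eval_nat_numeral add.assoc)

text \<open>A row index is 4x + 2k + z with binary digits for A, A' and B; a column index is 2q + w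
  with digits for A and B.\<close>

lemma meas_kron_index:
  assumes "i < 8" "j < 4"
  shows "kron (meas_iso 2 as) (1\<^sub>m 2) $$ (i,j) = (if i mod 2 = j mod 2
    then as ! (i div 2 mod 2) $ (i div 4) * cnj (as ! (i div 2 mod 2) $ (j div 2)) else 0)"
proof -
  have "i div 2 < 4" "j div 2 < 2" "i div 2 div 2 = i div 4" using assms by auto
  moreover have "i div 2 mod 2 = 0 \<or> i div 2 mod 2 = 1" by auto
  ultimately show ?thesis
    using assms by (auto simp: kron_def meas_iso_def numeral_2_eq_2)
qed

lemma kron_meas_carrier: "kron (meas_iso 2 as) (1\<^sub>m 2) \<in> carrier_mat 8 4"
  by (auto simp: kron_def meas_iso_def)

text \<open>Entrywise form of the sum over k, l of |a_k><a_l| on A, |k><l| on A' and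
  \<open>basis_block as \<rho> k l\<close> on B.\<close>

lemma post_state_index:
  assumes \<rho>: "\<rho> \<in> carrier_mat 4 4" and i: "i < 8" and j: "j < 8"
  shows "post_state as \<rho> $$ (i,j) = as ! (i div 2 mod 2) $ (i div 4) * cnj (as ! (j div 2 mod 2) $ (j div 4))
    * basis_block as \<rho> (i div 2 mod 2) (j div 2 mod 2) $$ (i mod 2, j mod 2)"
proof -
  define W where "W = kron (meas_iso 2 as) (1\<^sub>m 2)"
  have W: "W \<in> carrier_mat 8 4" unfolding W_def by (rule kron_meas_carrier)
  have cW: "cadj W $$ (m,j) = cnj (W $$ (j,m))" if "m < 4" for m
    using W j that by (intro cadj_index) auto
  have "post_state as \<rho> $$ (i,j) = (\<Sum>m<4. (\<Sum>n<4. W $$ (i,n) * \<rho> $$ (n,m)) * cnj (W $$ (j,m)))"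
    unfolding post_state_def Let_def W_def[symmetric]
    using mult_carrier_mat[OF W \<rho>] cadj_carrier[OF W] i j
    by (subst mat_mult_index[of _ 8 4 _ 8])
      (auto intro!: sum.cong simp: cW mat_mult_index[OF W \<rho>] simp del: index_mult_mat)
  moreover have "i mod 2 = 0 \<or> i mod 2 = 1" "j mod 2 = 0 \<or> j mod 2 = 1" by auto
  ultimately show ?thesis
    unfolding W_def using i j
    by (elim disjE) (simp_all add: sum_lessThan_4 meas_kron_index basis_block_index algebra_simps
        del: add_2_eq_Suc add_2_eq_Suc')
qed

text \<open>Only the A' digits of row and column are exchanged: |k><l| becomes |l><k|, while A and B
  keep the pair (k,l).\<close>

lemma ptrans_post_state_index:
  assumes \<rho>: "\<rho> \<in> carrier_mat 4 4" and i: "i < 8" and j: "j < 8"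
  shows "ptrans_mid 2 2 2 (post_state as \<rho>) $$ (i,j) =
    as ! (j div 2 mod 2) $ (i div 4) * cnj (as ! (i div 2 mod 2) $ (j div 4))
    * basis_block as \<rho> (j div 2 mod 2) (i div 2 mod 2) $$ (i mod 2, j mod 2)"
proof -
  have digits: "((x * 2 + y) * 2 + z) div 4 = x" "((x * 2 + y) * 2 + z) div 2 mod 2 = y"
    "((x * 2 + y) * 2 + z) mod 2 = z" "(x * 2 + y) * 2 + z < 8"
    if "x < 2" "y < 2" "z < 2" for x y z :: nat
    using that by (auto simp: less_2_cases_iff)
  have lt: "i div 4 < 2" "j div 4 < 2" "i div 2 mod 2 < 2" "j div 2 mod 2 < 2" "i mod 2 < 2" "j mod 2 < 2"
    using i j by auto
  have "ptrans_mid 2 2 2 (post_state as \<rho>) $$ (i,j) =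
    post_state as \<rho> $$ ((i div 4 * 2 + j div 2 mod 2) * 2 + i mod 2, (j div 4 * 2 + i div 2 mod 2) * 2 + j mod 2)"
    using i j by (simp add: ptrans_mid_def)
  then show ?thesis
    using lt by (simp only: post_state_index[OF \<rho>] digits)
qed

text \<open>Distinct pairs (k,l) have orthogonal outputs a_k, |l> on A and A'. The Gram matrix
  therefore splits, and the singular values of the whole are those of the four blocks
  together.\<close>

lemma trace_norm_ptrans_post_state:
  assumes \<rho>: "\<rho> \<in> carrier_mat 4 4" and as: "onb 2 as"
  shows "trace_norm (ptrans_mid 2 2 2 (post_state as \<rho>)) =
      trace_norm (basis_block as \<rho> 0 0) + trace_norm (basis_block as \<rho> 1 0)
    + trace_norm (basis_block as \<rho> 0 1) + trace_norm (basis_block as \<rho> 1 1)"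
proof -
  define P where "P = ptrans_mid 2 2 2 (post_state as \<rho>)"
  let ?b = "basis_block as \<rho>"
  \<comment> \<open>\<open>T\<close> rotates \<open>A\<close> to the measured basis; in it \<open>P\<close> permutes the blocks, so the Gram matrix of
    \<open>Y = P T\<close> is block diagonal.\<close>
  define T where "T = mat 8 8 (\<lambda>(i,j). if i mod 4 = j mod 4 then as ! (j div 4) $ (i div 4) else 0)"
  define Y where "Y = mat 8 8 (\<lambda>(i,j). if i div 2 mod 2 = j div 4
    then as ! (j div 2 mod 2) $ (i div 4) * ?b (j div 2 mod 2) (j div 4) $$ (i mod 2, j mod 2) else 0)"
  define G where "G k l = cadj (?b k l) * ?b k l" for k l
  have P: "P \<in> carrier_mat 8 8" by (simp add: P_def ptrans_mid_def)
  have T: "T \<in> carrier_mat 8 8" and Y: "Y \<in> carrier_mat 8 8" by (simp_all add: T_def Y_def)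
  have G: "G k l \<in> carrier_mat 2 2" for k l
    unfolding G_def by (rule mult_carrier_mat[OF cadj_carrier[OF basis_block_carrier] basis_block_carrier])
  have G_index: "G k l $$ (z,w) = cnj (?b k l $$ (0,z)) * ?b k l $$ (0,w) + cnj (?b k l $$ (1,z)) * ?b k l $$ (1,w)"
    if "z < 2" "w < 2" for k l z w
    unfolding G_def using that
    by (subst mat_mult_index[of _ 2 2 _ 2]) (auto simp: numeral_2_eq_2 carrier_matD[OF basis_block_carrier])
  have on: "cnj (as ! k $ 0) * (as ! l $ 0) + cnj (as ! k $ 1) * (as ! l $ 1) = (if k = l then 1 else 0)"
    if "k < 2" "l < 2" for k l using onb_inner[OF as that] .
  have T_sum: "(\<Sum>k<8. f k * T $$ (k,j)) = f (j mod 4) * (as ! (j div 4) $ 0) + f (4 + j mod 4) * (as ! (j div 4) $ 1)"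
    if "j < 8" for f j
  proof -
    have "j \<in> {0,1,2,3,4,5,6,7}" using that by auto
    then show ?thesis by (elim insertE emptyE) (simp_all add: sum_lessThan_8 T_def)
  qed
  have uni: "cadj T * T = 1\<^sub>m 8"
  proof (rule eq_matI)
    fix i j assume "i < dim_row (1\<^sub>m 8)" "j < dim_col (1\<^sub>m 8)"
    then have ij: "i < 8" "j < 8" by auto
    have lt: "i div 4 < 2" "j div 4 < 2" using ij by auto
    have "(cadj T * T) $$ (i,j) = (\<Sum>k<8. cnj (T $$ (k,i)) * T $$ (k,j))"
      using T ij by (subst mat_mult_index[of _ 8 8 _ 8]) auto
    also have "\<dots> = (if i mod 4 = j mod 4 then cnj (as ! (i div 4) $ 0) * (as ! (j div 4) $ 0)
         + cnj (as ! (i div 4) $ 1) * (as ! (j div 4) $ 1) else 0)"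
      unfolding T_sum[OF ij(2)] using ij by (simp add: T_def)
    also have "\<dots> = (if i = j then 1 else 0)"
      using on[OF lt] by (auto, metis div_mult_mod_eq)
    finally show "(cadj T * T) $$ (i,j) = 1\<^sub>m 8 $$ (i,j)" using ij by simp
  qed (use T in auto)
  have PT: "P * T = Y"
  proof (rule eq_matI)
    fix i j assume "i < dim_row Y" "j < dim_col Y"
    then have ij: "i < 8" "j < 8" using Y by auto
    have lt: "i div 2 mod 2 < 2" "j div 4 < 2" using ij by auto
    let ?k = "j div 2 mod 2" and ?y = "i div 2 mod 2" and ?l = "j div 4"
    let ?c = "as ! ?k $ (i div 4) * ?b ?k ?y $$ (i mod 2, j mod 2)"
    have "(P * T) $$ (i,j) = (\<Sum>k<8. P $$ (i,k) * T $$ (k,j))"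
      using T P ij by (subst mat_mult_index[of _ 8 8 _ 8]) auto
    \<comment> \<open>Summing over A produces the overlap of \<open>as ! ?y\<close> and
      \<open>as ! ?l\<close>, which forces the A' digit of the row to equal
      \<open>?l\<close>.\<close>
    also have "\<dots> = ?c * (cnj (as ! ?y $ 0) * (as ! ?l $ 0) + cnj (as ! ?y $ 1) * (as ! ?l $ 1))"
    proof -
      have j: "j \<in> {0,1,2,3,4,5,6,7}" using ij by auto
      have "j mod 4 < 8" "4 + j mod 4 < 8" "(j mod 4) div 4 = 0" "(4 + j mod 4) div 4 = 1"
        "(j mod 4) div 2 mod 2 = ?k" "(4 + j mod 4) div 2 mod 2 = ?k" "(j mod 4) mod 2 = j mod 2"
        "(4 + j mod 4) mod 2 = j mod 2"
        using j by auto
      then show ?thesis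
        unfolding P_def T_sum[OF ij(2)] by (simp only: ptrans_post_state_index[OF \<rho> ij(1)]) (simp add: algebra_simps)
    qed
    also have "\<dots> = Y $$ (i,j)"
      unfolding on[OF lt] using ij by (simp add: Y_def)
    finally show "(P * T) $$ (i,j) = Y $$ (i,j)" .
  qed (use P T Y in auto)
  \<comment> \<open>The outer column digit is the A label l and the inner one the A' label k, hence
    the order 00, 10, 01, 11 of the pairs (k,l).\<close>
  define D where "D = four_block_mat (four_block_mat (G 0 0) (0\<^sub>m 2 2) (0\<^sub>m 2 2) (G 1 0)) (0\<^sub>m 4 4) (0\<^sub>m 4 4)
      (four_block_mat (G 0 1) (0\<^sub>m 2 2) (0\<^sub>m 2 2) (G 1 1))"
  have YY: "cadj Y * Y = D"
  proof (rule eq_matI)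
    fix i j assume "i < dim_row D" "j < dim_col D"
    then have ij: "i < 8" "j < 8" using G by (auto simp: D_def carrier_matD[OF G])
    let ?k = "i div 2 mod 2" and ?k' = "j div 2 mod 2" and ?l = "i div 4" and ?l' = "j div 4"
    have lt: "?k < 2" "?k' < 2" using ij by auto
    have l: "?l \<in> {0,1}" "?l' \<in> {0,1}" using ij by auto
    have "(cadj Y * Y) $$ (i,j) = (\<Sum>k<8. cnj (Y $$ (k,i)) * Y $$ (k,j))"
      using Y ij by (subst mat_mult_index[of _ 8 8 _ 8]) auto
    also have "\<dots> = (if ?l = ?l' then (cnj (as ! ?k $ 0) * (as ! ?k' $ 0) + cnj (as ! ?k $ 1) * (as ! ?k' $ 1)) *
        (cnj (?b ?k ?l $$ (0,i mod 2)) * ?b ?k' ?l' $$ (0,j mod 2) + cnj (?b ?k ?l $$ (1,i mod 2)) * ?b ?k' ?l' $$ (1,j mod 2)) else 0)"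
      using ij l by (auto simp: sum_lessThan_8 Y_def algebra_simps)
    also have "\<dots> = (if ?l = ?l' \<and> ?k = ?k' then G ?k ?l $$ (i mod 2, j mod 2) else 0)"
      unfolding on[OF lt] by (simp add: G_index)
    also have "\<dots> = D $$ (i,j)"
    proof -
      have "D $$ (i,j) = (if i < 4 then if j < 4 then
            (if i < 2 then if j < 2 then G 0 0 $$ (i,j) else 0 else if j < 2 then 0 else G 1 0 $$ (i-2,j-2)) else 0
          else if j < 4 then 0 else
            (if i < 6 then if j < 6 then G 0 1 $$ (i-4,j-4) else 0 else if j < 6 then 0 else G 1 1 $$ (i-6,j-6)))"
        using ij by (auto simp: D_def carrier_matD[OF G])
      moreover have "i \<in> {0,1,2,3,4,5,6,7}" "j \<in> {0,1,2,3,4,5,6,7}" using ij by auto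
      ultimately show ?thesis
        by (elim insertE emptyE) simp_all
    qed
    finally show "(cadj Y * Y) $$ (i,j) = D $$ (i,j)" .
  qed (use Y in \<open>auto simp: D_def carrier_matD[OF G]\<close>)
  have cT: "cadj T \<in> carrier_mat 8 8" and cP: "cadj P \<in> carrier_mat 8 8" using T P by auto
  \<comment> \<open>Changing the basis of the columns alone already conjugates the Gram matrix, so
    its spectrum is preserved.\<close>
  have "cadj T * (cadj P * P) * T = cadj (P * T) * (P * T)"
    using assoc_mult_mat[OF cT mult_carrier_mat[OF cP P] T] assoc_mult_mat[OF cP P T]
      assoc_mult_mat[OF cT cP mult_carrier_mat[OF P T]] by (simp add: cadj_mult[OF P T])
  then have "char_poly (cadj P * P) = char_poly D"
    using char_poly_unitary_conj[OF _ T uni, of "cadj P * P"] mult_carrier_mat[OF cP P] by (simp add: PT YY)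
  also have "\<dots> = (char_poly (G 0 0) * char_poly (G 1 0)) * (char_poly (G 0 1) * char_poly (G 1 1))"
    unfolding D_def using four_block_carrier_mat[OF G G]
    by (simp add: char_poly_block_diag[of _ 4 _ 4] char_poly_block_diag[OF G G])
  finally have cp: "char_poly (cadj P * P) =
    (char_poly (G 0 0) * char_poly (G 1 0)) * (char_poly (G 0 1) * char_poly (G 1 1))" .
  have "\<forall>k l. \<exists>x. char_poly (G k l) = (\<Prod>y\<leftarrow>[fst x, snd x]. [:- complex_of_real y, 1:])
      \<and> trace_norm (?b k l) = sqrt (fst x) + sqrt (snd x)"
    unfolding G_def using trace_norm_2x2(2)[OF basis_block_carrier] by (metis fst_conv snd_conv)
  then obtain f where f: "\<And>k l. char_poly (G k l) = (\<Prod>y\<leftarrow>[fst (f k l), snd (f k l)]. [:- complex_of_real y, 1:])"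
      "\<And>k l. trace_norm (?b k l) = sqrt (fst (f k l)) + sqrt (snd (f k l))"
    by metis
  have "char_poly (cadj P * P) = (\<Prod>y\<leftarrow>[fst (f 0 0), snd (f 0 0), fst (f 1 0), snd (f 1 0),
     fst (f 0 1), snd (f 0 1), fst (f 1 1), snd (f 1 1)]. [:- complex_of_real y, 1:])"
    unfolding cp f by (simp only: list.map prod_list.Cons prod_list.Nil mult.assoc mult_1_right)
  from trace_norm_eqI[OF P this] show ?thesis
    by (simp add: P_def f)
qed

section \<open>Two-qubit states with maximally mixed marginal\<close>

lemma basis_block_entries:
  fixes as \<rho> k l
  defines "c \<equiv> \<lambda>p q. cnj (as ! k $ p) * (as ! l $ q)"
  shows "basis_block as \<rho> k l $$ (0,0) = c 0 0 * \<rho> $$ (0,0) + c 0 1 * \<rho> $$ (0,2) + c 1 0 * \<rho> $$ (2,0) + c 1 1 * \<rho> $$ (2,2)"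
    "basis_block as \<rho> k l $$ (0,1) = c 0 0 * \<rho> $$ (0,1) + c 0 1 * \<rho> $$ (0,3) + c 1 0 * \<rho> $$ (2,1) + c 1 1 * \<rho> $$ (2,3)"
    "basis_block as \<rho> k l $$ (1,0) = c 0 0 * \<rho> $$ (1,0) + c 0 1 * \<rho> $$ (1,2) + c 1 0 * \<rho> $$ (3,0) + c 1 1 * \<rho> $$ (3,2)"
    "basis_block as \<rho> k l $$ (1,1) = c 0 0 * \<rho> $$ (1,1) + c 0 1 * \<rho> $$ (1,3) + c 1 0 * \<rho> $$ (3,1) + c 1 1 * \<rho> $$ (3,3)"
  by (simp_all add: c_def basis_block_index numeral_3_eq_3 numeral_2_eq_2 algebra_simps)

lemma density_hermitian:
  assumes "density 4 \<rho>" "i < 4" "j < 4"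
  shows "cnj (\<rho> $$ (i,j)) = \<rho> $$ (j,i)"
proof -
  have "\<rho> \<in> carrier_mat 4 4" "cadj \<rho> = \<rho>" using assms by (auto simp: density_def)
  then show ?thesis using cadj_index[of j \<rho> i] assms by auto
qed

lemma basis_block_cnj:
  assumes \<rho>: "density 4 \<rho>" and "z < 2" "w < 2"
  shows "cnj (basis_block as \<rho> k l $$ (z,w)) = basis_block as \<rho> l k $$ (w,z)"
  using assms by (simp add: basis_block_index density_hermitian[OF \<rho>] algebra_simps)

text \<open>Positivity of \<open>\<rho>\<close> is tested on the product of \<open>as ! k\<close> on
  A with the vector (x, y) on B.\<close>

lemma basis_block_nonneg:
  assumes \<rho>: "density 4 \<rho>"
  shows "0 \<le> Re (cnj x * (basis_block as \<rho> k k $$ (0,0) * x + basis_block as \<rho> k k $$ (0,1) * y)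
      + cnj y * (basis_block as \<rho> k k $$ (1,0) * x + basis_block as \<rho> k k $$ (1,1) * y))"
proof -
  define v where "v = vec 4 (\<lambda>i. as ! k $ (i div 2) * (if i mod 2 = 0 then x else y))"
  have v: "v \<in> carrier_vec 4" by (simp add: v_def)
  have C: "\<rho> \<in> carrier_mat 4 4" using \<rho> by (simp add: density_def)
  have mv: "(\<rho> *\<^sub>v v) $ i = (\<Sum>j<4. \<rho> $$ (i,j) * v $ j)" if "i < 4" for i
    using C v that by (auto simp: scalar_prod_def lessThan_atLeast0 intro!: sum.cong)
  have ve: "v $ 0 = as ! k $ 0 * x" "v $ 1 = as ! k $ 0 * y" "v $ 2 = as ! k $ 1 * x" "v $ 3 = as ! k $ 1 * y"
    by (simp_all add: v_def)
  have "0 \<le> Re (\<Sum>i<4. cnj (v $ i) * (\<rho> *\<^sub>v v) $ i)"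
    using \<rho> v by (simp add: density_def)
  also have "(\<Sum>i<4. cnj (v $ i) * (\<rho> *\<^sub>v v) $ i) =
      cnj x * (basis_block as \<rho> k k $$ (0,0) * x + basis_block as \<rho> k k $$ (0,1) * y)
      + cnj y * (basis_block as \<rho> k k $$ (1,0) * x + basis_block as \<rho> k k $$ (1,1) * y)"
    unfolding sum_lessThan_4 by (simp only: mv sum_lessThan_4 ve zero_less_numeral one_less_numeral_iff
       numeral_less_iff num.simps less_num_simps semiring_norm)
     (simp add: ve ve(2)[unfolded One_nat_def] basis_block_index algebra_simps numeral_3_eq_3 numeral_2_eq_2)
  finally show ?thesis .
qed

lemma psd_2x2:
  fixes p s :: real and q :: complex
  assumes "\<And>x y. 0 \<le> Re (cnj x * (of_real p * x + q * y) + cnj y * (cnj q * x + of_real s * y))"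
  shows "0 \<le> p" "0 \<le> s" "(cmod q)\<^sup>2 \<le> p * s"
proof -
  show p: "0 \<le> p" and s: "0 \<le> s"
    using assms[of 1 0] assms[of 0 1] by auto
  have qq: "cnj q * q = of_real ((cmod q)\<^sup>2)" "q * cnj q = of_real ((cmod q)\<^sup>2)"
    by (simp_all only: complex_norm_square mult.commute)
  show "(cmod q)\<^sup>2 \<le> p * s"
  proof (cases "p = 0")
    case True
    show ?thesis
    proof (rule ccontr)
      assume *: "\<not> ?thesis"
      \<comment> \<open>Chosen so that the form at \<open>(- t q, 1)\<close> takes the value
        -1.\<close>
      define t where "t = (s + 1) / (2 * (cmod q)\<^sup>2)"
      have t: "2 * t * (cmod q)\<^sup>2 = s + 1" using * True by (simp add: t_def)
      have "cnj (- of_real t * q) * (of_real p * (- of_real t * q) + q * 1) + cnj 1 * (cnj q * (- of_real t * q) + of_real s * 1)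
        = of_real s - 2 * of_real t * (cnj q * q)"
        using True by (simp add: algebra_simps)
      also have "\<dots> = of_real (s - 2 * t * (cmod q)\<^sup>2)" unfolding qq by simp
      also have "s - 2 * t * (cmod q)\<^sup>2 = - 1" using t by simp
      finally have e: "cnj (- of_real t * q) * (of_real p * (- of_real t * q) + q * 1)
        + cnj 1 * (cnj q * (- of_real t * q) + of_real s * 1) = of_real (- 1)" .
      show False
        using assms[of "- of_real t * q" 1] unfolding e by simp
    qed
  next
    case False
    \<comment> \<open>The vector \<open>(- q, p)\<close> is killed by the first row, leaving
      \<open>p\<close> times the determinant.\<close>
    have "cnj (- q) * (of_real p * (- q) + q * of_real p) + cnj (of_real p) * (cnj q * (- q) + of_real s * of_real p)
        = of_real p * (of_real p * of_real s - cnj q * q)"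
      by (simp add: algebra_simps)
    also have "\<dots> = of_real (p * (p * s - (cmod q)\<^sup>2))" unfolding qq by simp
    finally have e: "cnj (- q) * (of_real p * (- q) + q * of_real p)
        + cnj (of_real p) * (cnj q * (- q) + of_real s * of_real p) = of_real (p * (p * s - (cmod q)\<^sup>2))" .
    have "0 \<le> p * (p * s - (cmod q)\<^sup>2)"
      using assms[of "- q" "of_real p"] unfolding e by simp
    then show ?thesis using p False by (simp add: zero_le_mult_iff)
  qed
qed

lemma marginal_entries:
  assumes "ptrace_B \<rho> = mat 2 2 (\<lambda>(i,j). if i = j then 1/2 else 0)"
  shows "\<rho> $$ (1,1) = 1/2 - \<rho> $$ (0,0)" "\<rho> $$ (1,3) = - \<rho> $$ (0,2)"
    "\<rho> $$ (3,1) = - \<rho> $$ (2,0)" "\<rho> $$ (3,3) = 1/2 - \<rho> $$ (2,2)"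
proof -
  have "ptrace_B \<rho> $$ (i,j) = (if i = j then 1/2 else 0)" if "i < 2" "j < 2" for i j
    using that by (simp add: assms)
  from this[of 0 0] this[of 0 1] this[of 1 0] this[of 1 1]
  have "\<rho> $$ (0,0) + \<rho> $$ (1,1) = 1/2" "\<rho> $$ (0,2) + \<rho> $$ (1,3) = 0"
    "\<rho> $$ (2,0) + \<rho> $$ (3,1) = 0" "\<rho> $$ (2,2) + \<rho> $$ (3,3) = 1/2"
    by (simp_all add: ptrace_B_def eval_nat_numeral)
  then show "\<rho> $$ (1,1) = 1/2 - \<rho> $$ (0,0)" "\<rho> $$ (1,3) = - \<rho> $$ (0,2)"
    "\<rho> $$ (3,1) = - \<rho> $$ (2,0)" "\<rho> $$ (3,3) = 1/2 - \<rho> $$ (2,2)"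
    by (simp_all add: eq_diff_eq eq_neg_iff_add_eq_0 add.commute)
qed

text \<open>The block is positive semidefinite, so its trace norm is its trace <a_k|rho_A|a_k>,
  which is 1/2 for the maximally mixed marginal.\<close>

lemma trace_norm_diagonal_block:
  assumes \<rho>: "density 4 \<rho>" and marg: "ptrace_B \<rho> = mat 2 2 (\<lambda>(i,j). if i = j then 1/2 else 0)"
    and as: "onb 2 as" and k: "k < 2"
  shows "trace_norm (basis_block as \<rho> k k) = 1/2"
proof -
  let ?b = "basis_block as \<rho> k k"
  define p s q where "p = Re (?b $$ (0,0))" and "s = Re (?b $$ (1,1))" and "q = ?b $$ (0,1)"
  have p: "?b $$ (0,0) = of_real p" and s: "?b $$ (1,1) = of_real s"
    using basis_block_cnj[OF \<rho>, of 0 0 as k k] basis_block_cnj[OF \<rho>, of 1 1 as k k]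
    by (auto simp: p_def s_def complex_eq_iff)
  have q: "?b $$ (0,1) = q" "?b $$ (1,0) = cnj q"
    using basis_block_cnj[OF \<rho>, of 0 1 as k k] by (auto simp: q_def)
  note psd = psd_2x2[OF basis_block_nonneg[OF \<rho>, of _ as k, unfolded p s q]]
  have "?b $$ (0,0) + ?b $$ (1,1) =
      1/2 * (cnj (as ! k $ 0) * (as ! k $ 0) + cnj (as ! k $ 1) * (as ! k $ 1))"
    unfolding basis_block_entries marginal_entries[OF marg] by (simp add: algebra_simps)
  also have "\<dots> = 1/2" using onb_inner[OF as k k] by simp
  finally have "complex_of_real (p + s) = of_real (1/2)" unfolding p s by simp
  then have ps: "p + s = 1/2" by (simp only: of_real_eq_iff)
  have "?b $$ (0,0) * ?b $$ (1,1) - ?b $$ (1,0) * ?b $$ (0,1) = of_real (p * s - (cmod q)\<^sup>2)"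
    unfolding p s q of_real_diff complex_norm_square by (simp add: mult.commute)
  then have "cmod (?b $$ (0,0) * ?b $$ (1,1) - ?b $$ (1,0) * ?b $$ (0,1)) = p * s - (cmod q)\<^sup>2"
    using psd by (simp only: norm_of_real)
  note d = this
  have "trace_norm ?b = sqrt (p\<^sup>2 + (cmod q)\<^sup>2 + (cmod q)\<^sup>2 + s\<^sup>2 + 2 * (p * s - (cmod q)\<^sup>2))"
    unfolding trace_norm_2x2(1)[OF basis_block_carrier] d
    by (simp only: p s q complex_mod_cnj norm_of_real power2_abs)
  also have "\<dots> = sqrt ((p + s)\<^sup>2)"
    by (simp add: power2_eq_square algebra_simps)
  finally show ?thesis by (simp add: ps)
qed

text \<open>Hermiticity makes the two blocks adjoint to each other, which preserves all entry moduli
  in total and the modulus of the determinant.\<close>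

lemma trace_norm_basis_block_swap:
  assumes "density 4 \<rho>"
  shows "trace_norm (basis_block as \<rho> l k) = trace_norm (basis_block as \<rho> k l)"
proof -
  let ?b = "basis_block as \<rho> k l"
  have b: "basis_block as \<rho> l k $$ (z,w) = cnj (?b $$ (w,z))" if "z < 2" "w < 2" for z w
    using basis_block_cnj[OF assms that(2,1)] by simp
  have "cnj (?b $$ (0,0)) * cnj (?b $$ (1,1)) - cnj (?b $$ (0,1)) * cnj (?b $$ (1,0))
     = cnj (?b $$ (0,0) * ?b $$ (1,1) - ?b $$ (1,0) * ?b $$ (0,1))" by simp
  then have "cmod (cnj (?b $$ (0,0)) * cnj (?b $$ (1,1)) - cnj (?b $$ (0,1)) * cnj (?b $$ (1,0)))
     = cmod (?b $$ (0,0) * ?b $$ (1,1) - ?b $$ (1,0) * ?b $$ (0,1))" by (simp only: complex_mod_cnj)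
  then show ?thesis
    unfolding trace_norm_2x2(1)[OF basis_block_carrier] by (simp add: b add_ac)
qed

text \<open>The diagonal blocks add up to the subtracted 1, and halving the two equal off-diagonal
  terms leaves one of them.\<close>

lemma negativity_eq_offdiagonal_block:
  assumes \<rho>: "density 4 \<rho>" and marg: "ptrace_B \<rho> = mat 2 2 (\<lambda>(i,j). if i = j then 1/2 else 0)"
    and as: "onb 2 as"
  shows "negativity_AB_A' (post_state as \<rho>) = trace_norm (basis_block as \<rho> 0 1)"
proof -
  have "\<rho> \<in> carrier_mat 4 4" using \<rho> by (simp add: density_def)
  from trace_norm_ptrans_post_state[OF this as] show ?thesis
    using trace_norm_diagonal_block[OF \<rho> marg as, of 0] trace_norm_diagonal_block[OF \<rho> marg as, of 1]
      trace_norm_basis_block_swap[OF \<rho>, of as 1 0]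
    by (simp add: negativity_AB_A'_def)
qed

section \<open>Pauli coordinates and Bloch vectors\<close>

text \<open>The matrix element <a_0|sigma_i|a_1>.\<close>

definition pauli_elem :: "complex vec list \<Rightarrow> nat \<Rightarrow> complex" where
  "pauli_elem as i = (\<Sum>p<2. \<Sum>q<2. cnj (as ! 0 $ p) * pauli i $$ (p,q) * (as ! 1 $ q))"

lemma pauli_index:
  "pauli (Suc 0) $$ (0,0) = 0" "pauli (Suc 0) $$ (0,Suc 0) = 1" "pauli (Suc 0) $$ (Suc 0,0) = 1" "pauli (Suc 0) $$ (Suc 0,Suc 0) = 0"
  "pauli 2 $$ (0,0) = 0" "pauli 2 $$ (0,Suc 0) = - \<i>" "pauli 2 $$ (Suc 0,0) = \<i>" "pauli 2 $$ (Suc 0,Suc 0) = 0"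
  "pauli 3 $$ (0,0) = 1" "pauli 3 $$ (0,Suc 0) = 0" "pauli 3 $$ (Suc 0,0) = 0" "pauli 3 $$ (Suc 0,Suc 0) = - 1"
  by (simp_all add: pauli_def mat_of_rows_list_def)

lemma pauli_carrier: "pauli i \<in> carrier_mat 2 2"
  by (auto simp: pauli_def mat_of_rows_list_def)

lemma pauli_elem_simps:
  "pauli_elem as 1 = cnj (as ! 0 $ 0) * (as ! 1 $ 1) + cnj (as ! 0 $ 1) * (as ! 1 $ 0)"
  "pauli_elem as 2 = - \<i> * cnj (as ! 0 $ 0) * (as ! 1 $ 1) + \<i> * cnj (as ! 0 $ 1) * (as ! 1 $ 0)"
  "pauli_elem as 3 = cnj (as ! 0 $ 0) * (as ! 1 $ 0) - cnj (as ! 0 $ 1) * (as ! 1 $ 1)"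
proof -
  have 2: "(\<Sum>i<2::nat. f i) = f 0 + f 1" for f :: "nat \<Rightarrow> complex" by (simp add: numeral_2_eq_2)
  show "pauli_elem as 1 = cnj (as ! 0 $ 0) * (as ! 1 $ 1) + cnj (as ! 0 $ 1) * (as ! 1 $ 0)"
    "pauli_elem as 2 = - \<i> * cnj (as ! 0 $ 0) * (as ! 1 $ 1) + \<i> * cnj (as ! 0 $ 1) * (as ! 1 $ 0)"
    "pauli_elem as 3 = cnj (as ! 0 $ 0) * (as ! 1 $ 0) - cnj (as ! 0 $ 1) * (as ! 1 $ 1)"
    by (simp_all add: pauli_elem_def 2 pauli_index algebra_simps)
qed

lemma Rhat_index:
  assumes \<rho>: "\<rho> \<in> carrier_mat 4 4" and ij: "i < 3" "j < 3"
  shows "Rhat \<rho> $$ (i,j) = (\<Sum>a<4. \<Sum>b<4. pauli (Suc i) $$ (a div 2, b div 2) * pauli (Suc j) $$ (a mod 2, b mod 2) * \<rho> $$ (b,a))"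
proof -
  let ?K = "kron (pauli (Suc i)) (pauli (Suc j))"
  have K: "?K \<in> carrier_mat 4 4"
    using carrier_matD[OF pauli_carrier] by (auto simp: kron_def)
  have ent: "?K $$ (a,b) = pauli (Suc i) $$ (a div 2, b div 2) * pauli (Suc j) $$ (a mod 2, b mod 2)"
    if "a < 4" "b < 4" for a b
    using that carrier_matD[OF pauli_carrier] by (simp add: kron_def)
  have "mtrace (?K * \<rho>) = (\<Sum>a<4. \<Sum>b<4. ?K $$ (a,b) * \<rho> $$ (b,a))"
    unfolding mtrace_def using carrier_matD(1)[OF K]
    by (auto intro!: sum.cong simp: mat_mult_index[OF K \<rho>] simp del: index_mult_mat(1))
  also have "\<dots> = (\<Sum>a<4. \<Sum>b<4. pauli (Suc i) $$ (a div 2, b div 2) * pauli (Suc j) $$ (a mod 2, b mod 2) * \<rho> $$ (b,a))"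
    by (intro sum.cong refl) (simp add: ent)
  finally show ?thesis using ij by (simp add: Rhat_def)
qed

lemma Rhat_entries:
  assumes \<rho>: "\<rho> \<in> carrier_mat 4 4"
  shows "Rhat \<rho> $$ (0,0) = \<rho> $$ (3,0) + \<rho> $$ (2,1) + \<rho> $$ (1,2) + \<rho> $$ (0,3)"
    "Rhat \<rho> $$ (0,1) = \<i> * (\<rho> $$ (2,1) - \<rho> $$ (3,0) + \<rho> $$ (0,3) - \<rho> $$ (1,2))"
    "Rhat \<rho> $$ (0,2) = \<rho> $$ (2,0) - \<rho> $$ (3,1) + \<rho> $$ (0,2) - \<rho> $$ (1,3)"
    "Rhat \<rho> $$ (1,0) = \<i> * (\<rho> $$ (1,2) + \<rho> $$ (0,3) - \<rho> $$ (3,0) - \<rho> $$ (2,1))"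
    "Rhat \<rho> $$ (1,1) = \<rho> $$ (2,1) + \<rho> $$ (1,2) - \<rho> $$ (3,0) - \<rho> $$ (0,3)"
    "Rhat \<rho> $$ (1,2) = \<i> * (\<rho> $$ (3,1) - \<rho> $$ (2,0) + \<rho> $$ (0,2) - \<rho> $$ (1,3))"
    "Rhat \<rho> $$ (2,0) = \<rho> $$ (1,0) + \<rho> $$ (0,1) - \<rho> $$ (3,2) - \<rho> $$ (2,3)"
    "Rhat \<rho> $$ (2,1) = \<i> * (\<rho> $$ (0,1) - \<rho> $$ (1,0) + \<rho> $$ (3,2) - \<rho> $$ (2,3))"
    "Rhat \<rho> $$ (2,2) = \<rho> $$ (0,0) - \<rho> $$ (1,1) - \<rho> $$ (2,2) + \<rho> $$ (3,3)"
  by (simp_all add: Rhat_index[OF \<rho>] sum_lessThan_4 pauli_index numeral_2_eq_2[symmetric] numeral_3_eq_3[symmetric] algebra_simps)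

lemma Rhat_real:
  assumes \<rho>: "density 4 \<rho>" and "i < 3" "j < 3"
  shows "Im (Rhat \<rho> $$ (i,j)) = 0"
proof -
  have C: "\<rho> \<in> carrier_mat 4 4" using \<rho> by (simp add: density_def)
  have "i \<in> {0,1,2}" "j \<in> {0,1,2}" using assms by auto
  then have "cnj (Rhat \<rho> $$ (i,j)) = Rhat \<rho> $$ (i,j)"
    by (elim insertE emptyE) (simp_all only: Rhat_entries[OF C], simp_all add: density_hermitian[OF \<rho>] algebra_simps)
  then show ?thesis by (simp add: complex_eq_iff)
qed

text \<open>In the Pauli expansion of 4 rho, the terms with the identity on A vanish because
  <a_0|a_1> = 0, and those with a Pauli matrix on A and the identity on B vanish by the marginal.
  What remains is the Pauli matrix of the vector \<open>w\<close>, indexed from 0.\<close>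

lemma offdiagonal_block_pauli:
  assumes C: "\<rho> \<in> carrier_mat 4 4" and marg: "ptrace_B \<rho> = mat 2 2 (\<lambda>(i,j). if i = j then 1/2 else 0)"
    and as: "onb 2 as"
  defines "w \<equiv> \<lambda>j. pauli_elem as 1 * Rhat \<rho> $$ (0,j) + pauli_elem as 2 * Rhat \<rho> $$ (1,j)
      + pauli_elem as 3 * Rhat \<rho> $$ (2,j)"
  shows "4 * basis_block as \<rho> 0 1 $$ (0,0) = w 2"
    "4 * basis_block as \<rho> 0 1 $$ (0,1) = w 0 - \<i> * w 1"
    "4 * basis_block as \<rho> 0 1 $$ (1,0) = w 0 + \<i> * w 1"
    "4 * basis_block as \<rho> 0 1 $$ (1,1) = - w 2"
proof -
  \<comment> \<open>Orthogonality of the basis removes one of the four products, so the claims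
    become linear identities in \<open>e\<close>, \<open>f\<close>, \<open>g\<close> over the
    entries of \<open>\<rho>\<close>.\<close>
  define e f g where "e = cnj (as ! 0 $ 0) * (as ! 1 $ 0)" and "f = cnj (as ! 0 $ 0) * (as ! 1 $ 1)"
    and "g = cnj (as ! 0 $ 1) * (as ! 1 $ 0)"
  have h: "cnj (as ! 0 $ 1) * (as ! 1 $ 1) = - e"
    using onb_inner[OF as, of 0 1] by (simp add: e_def eq_neg_iff_add_eq_0 add.commute)
  have m: "pauli_elem as 1 = f + g" "pauli_elem as 2 = - \<i> * f + \<i> * g" "pauli_elem as 3 = 2 * e"
    unfolding pauli_elem_simps h by (simp_all add: e_def f_def g_def mult.assoc)
  note unf = w_def m Rhat_entries[OF C] basis_block_entries h e_def[symmetric] f_def[symmetric] g_def[symmetric]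
    marginal_entries[OF marg]
  show "4 * basis_block as \<rho> 0 1 $$ (0,0) = w 2"
    "4 * basis_block as \<rho> 0 1 $$ (0,1) = w 0 - \<i> * w 1"
    "4 * basis_block as \<rho> 0 1 $$ (1,0) = w 0 + \<i> * w 1"
    "4 * basis_block as \<rho> 0 1 $$ (1,1) = - w 2"
    unfolding unf by (simp_all add: algebra_simps)
qed

text \<open>The real and imaginary parts of \<open>\<langle>a\<^sub>0|\<sigma>|a\<^sub>1\<rangle>\<close> form an orthonormal basis of the plane orthogonal to
  the Bloch vector of the measured basis.\<close>
definition bloch_re :: "complex vec list \<Rightarrow> real^3" where
  "bloch_re as = vector [Re (pauli_elem as 1), Re (pauli_elem as 2), Re (pauli_elem as 3)]"

definition bloch_im :: "complex vec list \<Rightarrow> real^3" where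
  "bloch_im as = vector [Im (pauli_elem as 1), Im (pauli_elem as 2), Im (pauli_elem as 3)]"

text \<open>The vector m = u + iv of Pauli elements has m.m = <a_0|a_1>^2 = 0, so u and v have equal
  length and are orthogonal; its squared norm 2 makes both unit vectors.\<close>

lemma bloch_orthonormal:
  assumes as: "onb 2 as"
  shows "inner (bloch_re as) (bloch_re as) = 1" "inner (bloch_im as) (bloch_im as) = 1"
    "inner (bloch_re as) (bloch_im as) = 0"
proof -
  define a b c d where "a = as ! 0 $ 0" and "b = as ! 0 $ 1" and "c = as ! 1 $ 0" and "d = as ! 1 $ 1"
  let ?m = "pauli_elem as"
  have ab: "cnj a * a + cnj b * b = 1" and cd: "cnj c * c + cnj d * d = 1" and z: "cnj a * c + cnj b * d = 0"
    using onb_inner[OF as, of 0 0] onb_inner[OF as, of 1 1] onb_inner[OF as, of 0 1]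
    by (simp_all add: a_def b_def c_def d_def)
  have m: "?m 1 = cnj a * d + cnj b * c" "?m 2 = - \<i> * cnj a * d + \<i> * cnj b * c" "?m 3 = cnj a * c - cnj b * d"
    unfolding pauli_elem_simps by (simp_all add: a_def b_def c_def d_def)
  have "?m 1 * ?m 1 + ?m 2 * ?m 2 + ?m 3 * ?m 3 = (cnj a * c + cnj b * d) * (cnj a * c + cnj b * d)"
    unfolding m by (simp add: algebra_simps)
  then have sq: "?m 1 * ?m 1 + ?m 2 * ?m 2 + ?m 3 * ?m 3 = 0" using z by simp
  have "?m 1 * cnj (?m 1) + ?m 2 * cnj (?m 2) + ?m 3 * cnj (?m 3)
     = 2 * ((cnj a * a + cnj b * b) * (cnj c * c + cnj d * d)) - (cnj a * c + cnj b * d) * (a * cnj c + b * cnj d)"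
    unfolding m by (simp add: algebra_simps)
  then have n: "?m 1 * cnj (?m 1) + ?m 2 * cnj (?m 2) + ?m 3 * cnj (?m 3) = 2"
    using ab cd z by simp
  have re: "inner (bloch_re as) (bloch_re as) = (Re (?m 1))\<^sup>2 + (Re (?m 2))\<^sup>2 + (Re (?m 3))\<^sup>2"
    and im: "inner (bloch_im as) (bloch_im as) = (Im (?m 1))\<^sup>2 + (Im (?m 2))\<^sup>2 + (Im (?m 3))\<^sup>2"
    and ri: "inner (bloch_re as) (bloch_im as) = Re (?m 1) * Im (?m 1) + Re (?m 2) * Im (?m 2) + Re (?m 3) * Im (?m 3)"
    by (simp_all add: bloch_re_def bloch_im_def inner_vec_def sum_3 power2_eq_square)
  have "inner (bloch_re as) (bloch_re as) - inner (bloch_im as) (bloch_im as) = 0"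
    using arg_cong[OF sq, of Re] by (simp add: re im power2_eq_square)
  moreover have "inner (bloch_re as) (bloch_re as) + inner (bloch_im as) (bloch_im as) = 2"
    using arg_cong[OF n, of Re] by (simp add: re im power2_eq_square)
  ultimately show "inner (bloch_re as) (bloch_re as) = 1" "inner (bloch_im as) (bloch_im as) = 1" by auto
  show "inner (bloch_re as) (bloch_im as) = 0"
    using arg_cong[OF sq, of Im] by (simp add: ri algebra_simps)
qed

text \<open>Every plane comes from some measurement: the eigenvectors of n.sigma satisfy
  <a_0|n.sigma|a_1> = 0, and its real and imaginary parts are the two inner products.\<close>

lemma bloch_plane_orthogonal_to:
  fixes n :: "real^3"
  assumes "inner n n = 1"
  obtains as where "onb 2 as" "inner n (bloch_re as) = 0" "inner n (bloch_im as) = 0"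
proof -
  \<comment> \<open>The usual spinor \<open>(1 + z, x + iy)\<close> of a Bloch vector degenerates at the south pole, but only the
    plane orthogonal to \<open>n\<close> matters, so \<open>n\<close> may be reflected into the upper half space.\<close>
  have *: "\<exists>as. onb 2 as \<and> inner n (bloch_re as) = 0 \<and> inner n (bloch_im as) = 0"
    if n: "inner n n = 1" "vec_nth n 3 \<ge> 0" for n :: "real^3"
  proof -
    define x y z where "x = vec_nth n 1" and "y = vec_nth n 2" and "z = vec_nth n 3"
    have xyz: "x * x + y * y + z * z = 1" and z: "0 \<le> z"
      using n by (simp_all add: x_def y_def z_def inner_vec_def sum_3)
    \<comment> \<open>Normalization: (1 + z)^2 + x^2 + y^2 = 2 (1 + z) on the unit sphere.\<close>
    define s where "s = 1 / sqrt (2 * (1 + z))"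
    have "s * s = 1 / (2 * (1 + z))" using z by (simp add: s_def)
    then have s: "2 * (s * s) * (1 + z) = 1" using z by simp
    define c where "c = Complex x y"
    have cc: "c * cnj c = of_real (x * x + y * y)" by (simp add: c_def complex_eq_iff)
    define as where "as = [vec 2 (\<lambda>i. if i = 0 then of_real (s * (1 + z)) else of_real s * c),
      vec 2 (\<lambda>i. if i = 0 then - of_real s * cnj c else of_real (s * (1 + z)))]"
    have ent: "as ! 0 $ 0 = of_real (s * (1 + z))" "as ! 0 $ 1 = of_real s * c"
      "as ! 1 $ 0 = - of_real s * cnj c" "as ! 1 $ 1 = of_real (s * (1 + z))"
      by (simp_all add: as_def)
    have xy: "x * x + y * y = (1 - z) * (1 + z)" using xyz by (simp add: algebra_simps)
    have unit: "of_real (s * (1 + z)) * of_real (s * (1 + z)) + of_real s * of_real s * (c * cnj c) = (1::complex)"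
    proof -
      have "s * (1 + z) * (s * (1 + z)) + s * s * ((1 - z) * (1 + z)) = 2 * (s * s) * (1 + z)"
        by (simp add: algebra_simps)
      then have "complex_of_real (s * (1 + z) * (s * (1 + z)) + s * s * ((1 - z) * (1 + z))) = 1"
        using s by simp
      then show ?thesis unfolding cc xy by (simp only: of_real_add of_real_mult)
    qed
    have "onb 2 as"
    proof -
      have 2: "(\<Sum>i<2::nat. f i) = f 0 + f 1" for f :: "nat \<Rightarrow> complex" by (simp add: numeral_2_eq_2)
      have inner: "cnj (as ! 0 $ 0) * (as ! 0 $ 0) + cnj (as ! 0 $ 1) * (as ! 0 $ 1) = 1"
        "cnj (as ! 1 $ 0) * (as ! 1 $ 0) + cnj (as ! 1 $ 1) * (as ! 1 $ 1) = 1"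
        "cnj (as ! 0 $ 0) * (as ! 1 $ 0) + cnj (as ! 0 $ 1) * (as ! 1 $ 1) = 0"
        "cnj (as ! 1 $ 0) * (as ! 0 $ 0) + cnj (as ! 1 $ 1) * (as ! 0 $ 1) = 0"
        unfolding ent using unit by (simp_all add: algebra_simps)
      show ?thesis
        unfolding onb_def 2
      proof (intro conjI allI impI)
        fix k assume "k < (2::nat)"
        then show "as ! k \<in> carrier_vec 2"
          unfolding less_2_cases_iff by (elim disjE) (simp_all add: as_def)
      next
        fix k l assume "k < (2::nat)" "l < (2::nat)"
        then show "cnj (as ! k $ 0) * (as ! l $ 0) + cnj (as ! k $ 1) * (as ! l $ 1) = (if k = l then 1 else 0)"
          unfolding less_2_cases_iff
          by (elim disjE) (simp_all only: inner One_nat_def[symmetric] refl if_True if_False zero_neq_one one_neq_zero)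
      qed (simp add: as_def)
    qed
    have m: "pauli_elem as 1 = of_real (s * s) * (of_real ((1 + z) * (1 + z)) - cnj c * cnj c)"
      "pauli_elem as 2 = - \<i> * of_real (s * s) * (of_real ((1 + z) * (1 + z)) + cnj c * cnj c)"
      "pauli_elem as 3 = - 2 * of_real (s * s) * of_real (1 + z) * cnj c"
      unfolding pauli_elem_simps ent by (simp_all add: algebra_simps)
    have c2: "of_real x - \<i> * of_real y = cnj c" "of_real x + \<i> * of_real y = c"
      by (simp_all add: c_def complex_eq_iff)
    have "of_real x * pauli_elem as 1 + of_real y * pauli_elem as 2 + of_real z * pauli_elem as 3
      = of_real (s * s) * (of_real ((1 + z) * (1 + z)) * (of_real x - \<i> * of_real y)
         - cnj c * cnj c * (of_real x + \<i> * of_real y) - 2 * of_real (z * (1 + z)) * cnj c)"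
      unfolding m by (simp add: algebra_simps)
    also have "\<dots> = of_real (s * s) * cnj c * (of_real ((1 + z) * (1 + z)) - c * cnj c - 2 * of_real (z * (1 + z)))"
      unfolding c2 by (simp add: algebra_simps)
    also have "of_real ((1 + z) * (1 + z)) - c * cnj c - 2 * of_real (z * (1 + z)) = (0::complex)"
      unfolding cc xy by (simp add: algebra_simps)
    finally have 0: "of_real x * pauli_elem as 1 + of_real y * pauli_elem as 2 + of_real z * pauli_elem as 3 = 0" by simp
    have "inner n (bloch_re as) = 0" "inner n (bloch_im as) = 0"
      using arg_cong[OF 0, of Re] arg_cong[OF 0, of Im]
      by (simp_all add: bloch_re_def bloch_im_def inner_vec_def sum_3 x_def y_def z_def)
    with \<open>onb 2 as\<close> show ?thesis by blast
  qed
  show ?thesis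
  proof (cases "vec_nth n 3 \<ge> 0")
    case True
    then show ?thesis using *[OF assms] that by blast
  next
    case False
    then show ?thesis using *[of "- n"] assms that by auto
  qed
qed

definition real_Rhat :: "complex mat \<Rightarrow> real^3^3" where
  "real_Rhat \<rho> = vector [vector [Re (Rhat \<rho> $$ (0,0)), Re (Rhat \<rho> $$ (0,1)), Re (Rhat \<rho> $$ (0,2))],
     vector [Re (Rhat \<rho> $$ (1,0)), Re (Rhat \<rho> $$ (1,1)), Re (Rhat \<rho> $$ (1,2))],
     vector [Re (Rhat \<rho> $$ (2,0)), Re (Rhat \<rho> $$ (2,1)), Re (Rhat \<rho> $$ (2,2))]]"

text \<open>For \<open>4 M\<close> the Pauli matrix of w = p + iq, the determinant of
  \<open>M\<close> is -(w.w)/16 and its squared Frobenius norm is |w|^2/8, where w.w = |p|^2 - |q|^2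
  + 2i p.q.\<close>

lemma pauli_vector_block_norm:
  assumes M: "M \<in> carrier_mat 2 2"
    and "4 * M $$ (0,0) = Complex p3 q3" "4 * M $$ (0,1) = Complex p1 q1 - \<i> * Complex p2 q2"
    "4 * M $$ (1,0) = Complex p1 q1 + \<i> * Complex p2 q2" "4 * M $$ (1,1) = - Complex p3 q3"
  shows "trace_norm M = sqrt (top_eig2 (p1\<^sup>2 + p2\<^sup>2 + p3\<^sup>2) (q1\<^sup>2 + q2\<^sup>2 + q3\<^sup>2) (p1 * q1 + p2 * q2 + p3 * q3) / 8)"
proof -
  let ?a = "p1\<^sup>2 + p2\<^sup>2 + p3\<^sup>2" and ?b = "q1\<^sup>2 + q2\<^sup>2 + q3\<^sup>2" and ?c = "p1 * q1 + p2 * q2 + p3 * q3"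
  have sc: "z = w / 4" if "4 * z = w" for z w :: complex
    using that by (simp add: nonzero_eq_divide_eq mult.commute)
  note M4 = assms(2-5)[THEN sc]
  have d: "M $$ (0,0) * M $$ (1,1) - M $$ (1,0) * M $$ (0,1) = - Complex (?a - ?b) (2 * ?c) / 16"
    unfolding M4 by (simp add: complex_eq_iff power2_eq_square field_simps)
  have det: "cmod (M $$ (0,0) * M $$ (1,1) - M $$ (1,0) * M $$ (0,1)) = sqrt ((?a - ?b)\<^sup>2 + 4 * ?c\<^sup>2) / 16"
    unfolding d by (simp only: norm_divide norm_minus_cancel norm_numeral complex_norm power_mult_distrib) simp
  have F: "(cmod (M $$ (0,0)))\<^sup>2 + (cmod (M $$ (0,1)))\<^sup>2 + (cmod (M $$ (1,0)))\<^sup>2 + (cmod (M $$ (1,1)))\<^sup>2 = (?a + ?b) / 8"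
    unfolding M4 cmod_power2 by (simp add: power2_eq_square field_simps)
  show ?thesis
    unfolding trace_norm_2x2(1)[OF M] det F by (simp add: top_eig2_def add_divide_distrib)
qed

lemma negativity_eq_top_eig2:
  assumes \<rho>: "density 4 \<rho>" and marg: "ptrace_B \<rho> = mat 2 2 (\<lambda>(i,j). if i = j then 1/2 else 0)"
    and as: "onb 2 as"
  defines "A \<equiv> real_Rhat \<rho> ** transpose (real_Rhat \<rho>)"
  shows "negativity_AB_A' (post_state as \<rho>) = sqrt (top_eig2 (inner (bloch_re as) (A *v bloch_re as))
      (inner (bloch_im as) (A *v bloch_im as)) (inner (bloch_re as) (A *v bloch_im as)) / 8)"
proof -
  have C: "\<rho> \<in> carrier_mat 4 4" using \<rho> by (simp add: density_def)
  let ?R = "real_Rhat \<rho>"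
  define p q where "p = bloch_re as v* ?R" and "q = bloch_im as v* ?R"
  let ?w = "\<lambda>j. pauli_elem as 1 * Rhat \<rho> $$ (0,j) + pauli_elem as 2 * Rhat \<rho> $$ (1,j) + pauli_elem as 3 * Rhat \<rho> $$ (2,j)"
  have w: "?w 0 = Complex (vec_nth p 1) (vec_nth q 1)" "?w 1 = Complex (vec_nth p 2) (vec_nth q 2)"
    "?w 2 = Complex (vec_nth p 3) (vec_nth q 3)"
    by (auto simp: complex_eq_iff Rhat_real[OF \<rho>] p_def q_def vector_matrix_mult_def sum_3 bloch_re_def bloch_im_def real_Rhat_def
        algebra_simps)
  \<comment> \<open>The form of R R^T is the inner product of the images under R^T, which turns the
    Gram entries of \<open>p\<close> and \<open>q\<close> into values of \<open>A\<close>.\<close>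
  have AA: "inner x (A *v y) = inner (x v* ?R) (y v* ?R)" for x y
    unfolding A_def by (metis dot_lmul_matrix matrix_vector_mul_assoc transpose_matrix_vector)
  have pq: "inner x y = vec_nth x 1 * vec_nth y 1 + vec_nth x 2 * vec_nth y 2 + vec_nth x 3 * vec_nth y 3" for x y :: "real^3"
    by (simp add: inner_vec_def sum_3)
  have "trace_norm (basis_block as \<rho> 0 1) = sqrt (top_eig2
    ((vec_nth p 1)\<^sup>2 + (vec_nth p 2)\<^sup>2 + (vec_nth p 3)\<^sup>2) ((vec_nth q 1)\<^sup>2 + (vec_nth q 2)\<^sup>2 + (vec_nth q 3)\<^sup>2)
    (vec_nth p 1 * vec_nth q 1 + vec_nth p 2 * vec_nth q 2 + vec_nth p 3 * vec_nth q 3) / 8)"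
    by (rule pauli_vector_block_norm[OF basis_block_carrier])
      (simp_all only: offdiagonal_block_pauli[OF C marg as] w)
  then show ?thesis
    unfolding negativity_eq_offdiagonal_block[OF \<rho> marg as] AA p_def[symmetric] q_def[symmetric]
    by (simp only: pq power2_eq_square)
qed

section \<open>Singular values of a real matrix of order three\<close>

text \<open>Bridge from fixed-size real matrices, where the spectral theorem was shown, to the type
  on which \<open>singular_values\<close> is defined. \<open>Suc\<close> shifts indices from 0 to
  indices from 1.\<close>

definition complex_mat3 :: "real^3^3 \<Rightarrow> complex mat" where
  "complex_mat3 A = mat 3 3 (\<lambda>(i,j). of_real (vec_nth (vec_nth A (of_nat (Suc i))) (of_nat (Suc j))))"

lemma complex_mat3_carrier [simp]: "complex_mat3 A \<in> carrier_mat 3 3"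
  by (simp add: complex_mat3_def)

lemma less_3_cases_iff: "i < (3::nat) \<longleftrightarrow> i = 0 \<or> i = 1 \<or> i = 2"
  by auto

lemma complex_mat3_mult: "complex_mat3 (A ** B) = complex_mat3 A * complex_mat3 B"
proof (rule eq_matI)
  fix i j assume "i < dim_row (complex_mat3 A * complex_mat3 B)" "j < dim_col (complex_mat3 A * complex_mat3 B)"
  then have ij: "i < 3" "j < 3" by (auto simp: complex_mat3_def)
  have 3: "(\<Sum>k<3::nat. f k) = f 0 + f 1 + f 2" for f :: "nat \<Rightarrow> complex" by (simp add: eval_nat_numeral)
  have "(complex_mat3 A * complex_mat3 B) $$ (i,j) = (\<Sum>k<3. complex_mat3 A $$ (i,k) * complex_mat3 B $$ (k,j))"
    by (rule mat_mult_index[OF _ _ ij]) auto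
  then show "complex_mat3 (A ** B) $$ (i,j) = (complex_mat3 A * complex_mat3 B) $$ (i,j)"
    unfolding 3 using ij by (simp add: complex_mat3_def matrix_matrix_mult_def sum_3)
qed (auto simp: complex_mat3_def)

lemma complex_mat3_transpose: "complex_mat3 (transpose A) = cadj (complex_mat3 A)"
  by (rule eq_matI) (auto simp: complex_mat3_def transpose_def)

lemma complex_mat3_one: "complex_mat3 (Finite_Cartesian_Product.mat 1) = 1\<^sub>m 3"
  by (rule eq_matI) (auto simp: complex_mat3_def less_3_cases_iff Finite_Cartesian_Product.mat_def)

lemma complex_mat3_real_Rhat:
  assumes "density 4 \<rho>"
  shows "complex_mat3 (real_Rhat \<rho>) = Rhat \<rho>"
proof (rule eq_matI)
  fix i j assume "i < dim_row (Rhat \<rho>)" "j < dim_col (Rhat \<rho>)"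
  then have ij: "i < 3" "j < 3" by (auto simp: Rhat_def)
  then have "complex_mat3 (real_Rhat \<rho>) $$ (i,j) = of_real (Re (Rhat \<rho> $$ (i,j)))"
    by (auto simp: complex_mat3_def less_3_cases_iff real_Rhat_def)
  then show "complex_mat3 (real_Rhat \<rho>) $$ (i,j) = Rhat \<rho> $$ (i,j)"
    using Rhat_real[OF assms ij] by (simp add: complex_eq_iff)
qed (auto simp: complex_mat3_def Rhat_def)

lemma char_poly_diag3:
  "char_poly (complex_mat3 (diag3 a b c)) = (\<Prod>l\<leftarrow>[a, b, c]. [:- complex_of_real l, 1:])"
proof -
  have "upper_triangular (complex_mat3 (diag3 a b c))"
    by (auto simp: upper_triangular_def complex_mat3_def diag3_def less_3_cases_iff less_2_cases_iff)
  from char_poly_upper_triangular[OF complex_mat3_carrier this]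
  show ?thesis
    by (simp add: diag_mat_def complex_mat3_def diag3_def upt_rec numeral_3_eq_3)
qed

text \<open>\<open>cadj R * R\<close> has the characteristic polynomial of R R^T, which
  \<open>E\<close> diagonalizes; the assumed order fixes the sorted list.\<close>

lemma singular_values_complex_mat3:
  assumes E: "orthogonal_matrix E" "E ** (R ** transpose R) ** transpose E = diag3 a b c" "a \<ge> b" "b \<ge> c"
  shows "singular_values (complex_mat3 R) = [sqrt a, sqrt b, sqrt c]"
proof -
  let ?R = "complex_mat3 R" and ?T = "complex_mat3 (transpose E)"
  have T: "cadj ?T = complex_mat3 E"
    by (simp add: complex_mat3_transpose[symmetric])
  have "char_poly (cadj ?R * ?R) = char_poly (?R * cadj ?R)"
    by (rule char_poly_mult_commute[of _ 3]) auto
  also have "?R * cadj ?R = complex_mat3 (R ** transpose R)"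
    by (simp add: complex_mat3_mult complex_mat3_transpose)
  also have "char_poly \<dots> = char_poly (cadj ?T * complex_mat3 (R ** transpose R) * ?T)"
  proof (rule char_poly_unitary_conj[symmetric])
    show "cadj ?T * ?T = 1\<^sub>m 3"
      using E(1) by (simp add: T complex_mat3_mult[symmetric] orthogonal_matrix_def complex_mat3_one)
  qed auto
  also have "cadj ?T * complex_mat3 (R ** transpose R) * ?T = complex_mat3 (diag3 a b c)"
    by (simp only: T complex_mat3_mult[symmetric] E(2))
  finally have "char_poly (cadj ?R * ?R) = (\<Prod>l\<leftarrow>[a, b, c]. [:- complex_of_real l, 1:])"
    by (simp only: char_poly_diag3)
  from singular_values_eqI[OF complex_mat3_carrier this]
  have "singular_values ?R = rev (sort [sqrt a, sqrt b, sqrt c])" by simp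
  moreover have "sort [sqrt a, sqrt b, sqrt c] = [sqrt c, sqrt b, sqrt a]"
    using E(3,4) by (intro properties_for_sort) auto
  ultimately show ?thesis by simp
qed

theorem theorem12:
  fixes \<rho> :: "complex mat"
  assumes "density 4 \<rho>"
    and "ptrace_B \<rho> = mat 2 2 (\<lambda>(i,j). if i = j then 1/2 else 0)"
  shows "QN_A \<rho> = singular_values (Rhat \<rho>) ! 1 / 2
    \<and> (\<exists>as. onb 2 as \<and> negativity_AB_A' (post_state as \<rho>) = QN_A \<rho>)"
proof -
  let ?R = "real_Rhat \<rho>"
  define A where "A = ?R ** transpose ?R"
  have sym: "transpose A = A"
    by (simp add: A_def matrix_transpose_mul)
  obtain E a b c where E: "orthogonal_matrix E" "E ** A ** transpose E = diag3 a b c" "a \<ge> b" "b \<ge> c"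
    by (rule real_symmetric_diagonalization_3[OF sym])
  define s where "s = singular_values (Rhat \<rho>) ! 1 / 2"
  \<comment> \<open>Index 1 is the second singular value \<open>sqrt b\<close>; its half is the
    negativity formula evaluated at \<open>top_eig2 = 2 * b\<close>.\<close>
  have s: "s = sqrt (2 * b / 8)"
    using singular_values_complex_mat3[OF E(1) E(2)[unfolded A_def] E(3,4)]
    by (simp add: s_def complex_mat3_real_Rhat[OF assms(1)] real_sqrt_divide)
  note neg = negativity_eq_top_eig2[OF assms, folded A_def]
  have lower: "s \<le> negativity_AB_A' (post_state as \<rho>)" if as: "onb 2 as" for as
    using top_eig2_plane_ge[OF E(1-3) sym bloch_orthonormal[OF as]] by (simp add: neg[OF as] s)
  have "inner (vec_nth E 1) (vec_nth E 1) = 1"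
  proof -
    have "vec_nth (vec_nth (E ** transpose E) 1) 1 = 1"
      using E(1) by (simp add: orthogonal_matrix_def Finite_Cartesian_Product.mat_def)
    then show ?thesis
      by (simp add: matrix_matrix_mult_def transpose_def inner_vec_def)
  qed
  \<comment> \<open>The optimal measurement has its Bloch vector along the top eigenvector of
    \<open>A\<close>, the first row of \<open>E\<close>.\<close>
  then obtain as where as: "onb 2 as" "inner (vec_nth E 1) (bloch_re as) = 0" "inner (vec_nth E 1) (bloch_im as) = 0"
    by (rule bloch_plane_orthogonal_to)
  have "negativity_AB_A' (post_state as \<rho>) \<le> s"
    using top_eig2_plane_le[OF E(1,2,4) sym bloch_orthonormal[OF as(1)] as(2,3)] by (simp add: neg[OF as(1)] s)
  with lower[OF as(1)] have attained: "negativity_AB_A' (post_state as \<rho>) = s" by simp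
  \<comment> \<open>A lower bound that is attained: the infimum is a minimum.\<close>
  have "QN_A \<rho> = s"
    unfolding QN_A_def by (rule cInf_eq_minimum) (use attained as(1) lower in auto)
  then show ?thesis
    using attained as(1) by (auto simp: s_def)
qed

end
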